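(* Let $h:\mathbb{R}^2\to\mathbb{R}$ be a measurable kernel, $b\in(0,1)$ fixed, and consider the alternative in which the observations are $$X_{i,m}=1_{\{1\le i\le k^*+m\}}Y_i+1_{\{i>k^*+m\}}Z_{i,m},\quad i\ge1,$$ with stationary time series $\{Y_i\}_{i\in\mathbb{Z}}$ and $\{Z_{i,m}\}_{i\in\mathbb{Z}}$ and a finite change point $k^*<\infty$ (which may depend on $m$). Assume that the weight function $w$ (with associated $\rho$ and $\gamma$) satisfies Conditions (W), that $\{Y_i\}$ and $h$ satisfy Conditions (R) with this $\gamma$, and that $\{Y_i\}$, $\{Z_{i,m}\}$ and $h$ satisfy Conditions (A). Assume furthermore that $\sqrt m\,|\Delta_m|\to\infty$ and that the following holds: (V1) if $\frac{k^*}{m}\to\infty$, then $\liminf_{t\to\infty}t\rho(t)>0$. Then $$\sup_{k\ge1}w(m,k)\,|\Psi_j(m,k)|\stackrel{P}{\to}\infty\qquad(m\to\infty)$$ for $j=1,3$ provided that (V2) if $\frac{k^*}{m}=O(1)$, i.e. $\frac{k^*}{m}<\nu$ for all $m\ge1$ for some $\nu>0$, then there exist $t_0>\nu$, $\epsilon>0$ such that $\rho(t)>0$ for all $t\in(t_0-\epsilon,t_0+\epsilon)$, and for $j=2$ provided that (V3) if $\frac{k^*}{m}=O(1)$, i.e. $\frac{k^*}{m}<\nu$ for all $m\ge1$ for some $\nu>0$, then there exist $t_0>\nu$, $\epsilon>0$ such that $\rho(t)>0$ for all $t\in\left(\frac{t_0}{b}-\epsilon,\frac{t_0}{b}+\e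psilon\right)$.
   Context: Setting. $m\ge1$ is the length of a historic data set $X_{1,m},\dots,X_{m,m}$; $k\ge1$ is the monitoring time. Let $Y\stackrel{\mathcal D}{=}Y_1$ be an independent copy of $Y_1$, also independent of $\{Z_{i,m}\}$, and let $Z_m\stackrel{\mathcal D}{=}Z_{1,m}$ be independent of $Y$. Put $\theta=\operatorname{E}(h(Y,Y_1))$, $\theta_m^*=\operatorname{E}(h(Y,Z_m))$, $\Delta_m=\theta_m^*-\theta$. Define (writing $X_i=X_{i,m}$) $$\Gamma(m,k)=\frac1m\sum_{i=1}^m\sum_{j=m+1}^{m+k}(h(X_i,X_j)-\theta),$$ and the monitoring statistics $\Psi_1(m,k)=\Gamma(m,k)$ (CUSUM); $\Psi_2(m,k)=\Gamma(m,k)-\Gamma(m,\lfloor kb\rfloor)=\frac1m\sum_{i=1}^m\sum_{j=m+\lfloor kb\rfloor+1}^{m+k}(h(X_i,X_j)-\theta)$ (modified MOSUM); $\Psi_3(m,k)=\sup_{0\le l\le k}|\Gamma(m,k)-\Gamma(m,l)|$ with $\Gamma(m,0)=0$, $l$ integer (Page-CUSUM). Hoeffding decomposition for the series before the change: $h_1(x_1)=\operatorname{E}(h(x_1,Y_1))-\theta$, $h_2(x_2)=\operatorname{E}(h(Y_1,x_2))-\theta$, $r(x_1,x_2)=h(x_1,x_2)-h_1(x_1)-h_2(x_2)-\theta$. Hoeffding decomposition under the alternative: $h^*_{1,m}(y)=\operatorname{E}h(y,Z_m)-\theta_m^*$, $h^*_{2,m}(z)=h_2(z)-\Delta_m$,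 $r^*_m(y,z)=h(y,z)-h^*_{1,m}(y)-h^*_{2,m}(z)-\theta_m^*$. Conditions (W) on the weight function: (i) $w(m,k)=m^{-1/2}\tilde w(m,k)$, where $\tilde w(m,k)=\rho(k/m)$ for $k>l_m$ and $\tilde w(m,k)=0$ for $k\le l_m$, for a sequence $l_m$ with $l_m/m\to0$; the function $\rho:(0,\infty)\to\mathbb{R}^+$ is positive and continuous. (ii) $\lim_{t\to0}t^\gamma\rho(t)$ exists and is finite for some $0\le\gamma<\frac12$. (iii) $\lim_{t\to\infty}t\rho(t)$ exists and is finite. Conditions (R) on $\{Y_i\}$ and $h$: (i) $\operatorname{E}\big(\big|\sum_{i=1}^m\sum_{j=k_1}^{k_2}r(Y_i,Y_j)\big|^2\big)\le u(m)(k_2-k_1+1)$ for all $m+1\le k_1\le k_2$, with $\frac{u(m)}{m^{2-2\gamma}}\log(m)^2\to0$ as $m\to\infty$, $\gamma$ as in (W)(ii). (ii) For any $T>0$, $\{\frac1{\sqrt m}\sum_{i=1}^{\lfloor mt\rfloor}(h_1(Y_i),h_2(Y_i)):0<t\le T\}\stackrel{D}{\to}\{(\tilde W_1(t),\tilde W_2(t)):0<t\le T\}$ (functional central limit theorem), where $(\tilde W_1,\tilde W_2)$ is a bivariate Wiener process with mean zero and covariance matrix $\Sigma=\begin{pmatrix}\sigma_1^2&\varrho\\ \varrho&\sigma_2^2\end{pmatrix}$ (for some $\varrho$), with $\sigma_1^2=\sum_{n\in\mathbb{Z}}\operatorname{Cov}(h_1(Y_0),h_1(Y_n))$, $\sigma_2^2=\sum_{n\in\mathbb{Z}}\operatorname{Cov}(h_2(Y_0),h_2(Y_n))$.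 (iii) For all $0\le\alpha<\frac12$: $\sup_{1\le k\le m}\frac{1}{m^{1/2-\alpha}k^\alpha}\big|\sum_{j=1}^kh_2(Y_j)\big|=O_P(1)$ as $m\to\infty$. (iv) Uniformly in $m$, for any sequence $k_m>0$: $\sup_{k\ge k_m}\frac1k\big|\sum_{j=1}^kh_2(Y_j)\big|=O_P(1/\sqrt{k_m})$ as $k_m\to\infty$. Conditions (A) on $\{Y_i\}$, $\{Z_{i,m}\}$ and $h$: (i) $\sum_{i=1}^m\sum_{j=k_1}^{k_2}r_m^*(Y_i,Z_{j,m})=O_P\big(\sqrt{m(k_2-k_1+1)\max(m,k_2-k_1+1)}\big)$ for all sequences $k_1=k_1(m)\le k_2=k_2(m)$. (ii) $\frac1{\sqrt m}\sum_{i=1}^mh^*_{1,m}(Y_i)=O_P(1)$ as $m\to\infty$. (iii) $\frac{1}{\sqrt{k_m}}\sum_{j=m+k^*+1}^{m+k^*+k_m}h^*_{2,m}(Z_{j,m})=O_P(1)$ as $k_m\to\infty$.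
   Formalization: Added assumption: k*/m tends to infinity, or k*/m is bounded, or liminf tρ(t) > 0; for k* oscillating between m and m² with ρ(t) = (1+t)^{-2} and constant nonzero Δ_m, the claim as stated fails. *)

theory Defs
  imports "HOL-Probability.Probability"
begin

section \<open>Stochastic boundedness and convergence to infinity\<close>

text \<open>Both notions are stated for extended-real variables, since they are applied to suprema over
  infinitely many indices. They only concern \<open>m \<rightarrow> \<infinity>\<close>, so the value at \<open>m = 0\<close> is irrelevant.\<close>

definition bigO_P :: "'a measure \<Rightarrow> (nat \<Rightarrow> 'a \<Rightarrow> ereal) \<Rightarrow> (nat \<Rightarrow> real) \<Rightarrow> bool" where
  "bigO_P M X a \<longleftrightarrow>
     (\<forall>\<epsilon>>0. \<exists>C::real. \<forall>\<^sub>F m in sequentially.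
        measure M {\<omega> \<in> space M. \<bar>X m \<omega>\<bar> > ereal (C * a m)} < \<epsilon>)"

definition tendsto_infinity_in_prob :: "'a measure \<Rightarrow> (nat \<Rightarrow> 'a \<Rightarrow> ereal) \<Rightarrow> bool" where
  "tendsto_infinity_in_prob M X \<longleftrightarrow>
     (\<forall>C::real. (\<lambda>m. measure M {\<omega> \<in> space M. X m \<omega> > ereal C}) \<longlonglongrightarrow> 1)"

section \<open>Strictly stationary sequences\<close>

definition stationary_process :: "'a measure \<Rightarrow> (int \<Rightarrow> 'a \<Rightarrow> real) \<Rightarrow> bool" where
  "stationary_process M Y \<longleftrightarrow>
     (\<forall>i. Y i \<in> borel_measurable M) \<and>
     (\<forall>s. distr M (PiM UNIV (\<lambda>_. borel)) (\<lambda>\<omega> i. Y (i + s) \<omega>) =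
          distr M (PiM UNIV (\<lambda>_. borel)) (\<lambda>\<omega> i. Y i \<omega>))"

section \<open>Weak convergence in the Skorokhod space\<close>

text \<open>\<open>D[0,T]\<close> with Skorokhod's J1 metric. Paths are total functions of which only the
  restriction to \<open>{0..T}\<close> matters: a functional that is continuous for \<open>skorokhod_dist\<close> takes the same
  value on paths that agree there. The partial sum paths and the Wiener paths considered
  below vanish at 0, so \<open>{0..T}\<close> and \<open>{0<..T}\<close> are interchangeable as index sets.\<close>

definition cadlag :: "real \<Rightarrow> (real \<Rightarrow> 'b::metric_space) \<Rightarrow> bool" where
  "cadlag T x \<longleftrightarrow>
     (\<forall>t\<in>{0..<T}. (x \<longlongrightarrow> x t) (at_right t)) \<and>
     (\<forall>t\<in>{0<..T}. \<exists>l. (x \<longlongrightarrow> l) (at_left t))"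

definition time_change :: "real \<Rightarrow> (real \<Rightarrow> real) \<Rightarrow> bool" where
  "time_change T \<tau> \<longleftrightarrow> strict_mono_on {0..T} \<tau> \<and> \<tau> ` {0..T} = {0..T}"

definition skorokhod_dist ::
    "real \<Rightarrow> (real \<Rightarrow> 'b::metric_space) \<Rightarrow> (real \<Rightarrow> 'b) \<Rightarrow> real" where
  "skorokhod_dist T x y =
     Inf {e. 0 \<le> e \<and> (\<exists>\<tau>. time_change T \<tau> \<and>
            (\<forall>t\<in>{0..T}. \<bar>\<tau> t - t\<bar> \<le> e \<and> dist (x t) (y (\<tau> t)) \<le> e))}"

definition skorokhod_continuous ::
    "real \<Rightarrow> ((real \<Rightarrow> 'b::metric_space) \<Rightarrow> real) \<Rightarrow> bool" where
  "skorokhod_continuous T F \<longleftrightarrow>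
     (\<forall>x. cadlag T x \<longrightarrow> (\<forall>e>0. \<exists>d>0. \<forall>y. cadlag T y \<longrightarrow>
        skorokhod_dist T x y < d \<longrightarrow> \<bar>F y - F x\<bar> < e))"

definition weakly_converges_D ::
    "real \<Rightarrow> 'a measure \<Rightarrow> (nat \<Rightarrow> real \<Rightarrow> 'a \<Rightarrow> 'b::metric_space) \<Rightarrow>
     'c measure \<Rightarrow> (real \<Rightarrow> 'c \<Rightarrow> 'b) \<Rightarrow> bool" where
  "weakly_converges_D T M S N W \<longleftrightarrow>
     (\<forall>F. skorokhod_continuous T F \<longrightarrow> (\<exists>B. \<forall>x. cadlag T x \<longrightarrow> \<bar>F x\<bar> \<le> B) \<longrightarrow>
        (\<lambda>m. \<integral>\<omega>. F (\<lambda>t. S m t \<omega>) \<partial>M) \<longlonglongrightarrow> (\<integral>\<omega>. F (\<lambda>t. W t \<omega>) \<partial>N))"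

text \<open>Bivariate Wiener process with mean zero and covariance matrix \<open>((s11, s12), (s12, s22))\<close>.
  The Gaussian law of the increments is given by its characteristic function, because the
  covariance matrix may be singular.\<close>

definition bivariate_wiener ::
    "'c measure \<Rightarrow> (real \<Rightarrow> 'c \<Rightarrow> real \<times> real) \<Rightarrow> real \<Rightarrow> real \<Rightarrow> real \<Rightarrow> bool" where
  "bivariate_wiener N W s11 s12 s22 \<longleftrightarrow>
     prob_space N \<and>
     (\<forall>t\<ge>0. W t \<in> borel_measurable N) \<and>
     (\<forall>\<omega>\<in>space N. W 0 \<omega> = 0 \<and> continuous_on {0..} (\<lambda>t. W t \<omega>)) \<and>
     (\<forall>s t. 0 \<le> s \<longrightarrow> s \<le> t \<longrightarrow> (\<forall>a c.
        (CLINT \<omega>|N. iexp (a * fst (W t \<omega> - W s \<omega>) + c * snd (W t \<omega> - W s \<omega>))) =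
        complex_of_real (exp (- (t - s) * (a\<^sup>2 * s11 + 2 * a * c * s12 + c\<^sup>2 * s22) / 2)))) \<and>
     (\<forall>n (\<tau> :: nat \<Rightarrow> real). 0 \<le> \<tau> 0 \<longrightarrow> mono \<tau> \<longrightarrow>
        prob_space.indep_vars N (\<lambda>_. borel) (\<lambda>i \<omega>. W (\<tau> (Suc i)) \<omega> - W (\<tau> i) \<omega>) {..<n})"

definition covar :: "'a measure \<Rightarrow> ('a \<Rightarrow> real) \<Rightarrow> ('a \<Rightarrow> real) \<Rightarrow> real" where
  "covar M U V =
     (\<integral>\<omega>. (U \<omega> - (\<integral>\<omega>'. U \<omega>' \<partial>M)) * (V \<omega> - (\<integral>\<omega>'. V \<omega>' \<partial>M)) \<partial>M)"

section \<open>Kernel and Hoeffding decompositions\<close>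

text \<open>The expectation of \<open>h (U', V')\<close> for independent \<open>U'\<close>, \<open>V'\<close> distributed as \<open>U\<close>, \<open>V\<close>. Taking the
  product of the laws avoids having to find independent copies on \<open>M\<close> itself.\<close>

abbreviation product_law :: "'a measure \<Rightarrow> ('a \<Rightarrow> real) \<Rightarrow> ('a \<Rightarrow> real) \<Rightarrow> (real \<times> real) measure"
  where "product_law M U V \<equiv> distr M borel U \<Otimes>\<^sub>M distr M borel V"

definition indep_expectation ::
    "'a measure \<Rightarrow> (real \<Rightarrow> real \<Rightarrow> real) \<Rightarrow> ('a \<Rightarrow> real) \<Rightarrow> ('a \<Rightarrow> real) \<Rightarrow> real" where
  "indep_expectation M h U V = (\<integral>p. h (fst p) (snd p) \<partial>product_law M U V)"

definition theta where
  "theta M h (Y :: int \<Rightarrow> 'a \<Rightarrow> real) = indep_expectation M h (Y 1) (Y 1)"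

definition theta_star where
  "theta_star M h (Y :: int \<Rightarrow> 'a \<Rightarrow> real) (Z :: nat \<Rightarrow> int \<Rightarrow> 'a \<Rightarrow> real) m =
     indep_expectation M h (Y 1) (Z m 1)"

definition Delta where
  "Delta M h Y Z m = theta_star M h Y Z m - theta M h Y"

definition h1 where
  "h1 M h (Y :: int \<Rightarrow> 'a \<Rightarrow> real) x = (\<integral>\<omega>. h x (Y 1 \<omega>) \<partial>M) - theta M h Y"

definition h2 where
  "h2 M h (Y :: int \<Rightarrow> 'a \<Rightarrow> real) x = (\<integral>\<omega>. h (Y 1 \<omega>) x \<partial>M) - theta M h Y"

definition remainder where
  "remainder M h (Y :: int \<Rightarrow> 'a \<Rightarrow> real) x y = h x y - h1 M h Y x - h2 M h Y y - theta M h Y"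

definition h1_star where
  "h1_star M h (Y :: int \<Rightarrow> 'a \<Rightarrow> real) (Z :: nat \<Rightarrow> int \<Rightarrow> 'a \<Rightarrow> real) m y =
     (\<integral>\<omega>. h y (Z m 1 \<omega>) \<partial>M) - theta_star M h Y Z m"

definition h2_star where
  "h2_star M h (Y :: int \<Rightarrow> 'a \<Rightarrow> real) (Z :: nat \<Rightarrow> int \<Rightarrow> 'a \<Rightarrow> real) m z =
     h2 M h Y z - Delta M h Y Z m"

definition remainder_star where
  "remainder_star M h (Y :: int \<Rightarrow> 'a \<Rightarrow> real) (Z :: nat \<Rightarrow> int \<Rightarrow> 'a \<Rightarrow> real) m y z =
     h y z - h1_star M h Y Z m y - h2_star M h Y Z m z - theta_star M h Y Z m"

section \<open>Observations and monitoring statistics\<close>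

definition obs ::
    "(int \<Rightarrow> 'a \<Rightarrow> real) \<Rightarrow> (nat \<Rightarrow> int \<Rightarrow> 'a \<Rightarrow> real) \<Rightarrow> (nat \<Rightarrow> nat) \<Rightarrow>
     nat \<Rightarrow> nat \<Rightarrow> 'a \<Rightarrow> real" where
  "obs Y Z kstar m i \<omega> = (if i \<le> kstar m + m then Y (int i) \<omega> else Z m (int i) \<omega>)"

text \<open>In the following, \<open>X m i\<close> is the \<open>i\<close>-th observation of the \<open>m\<close>-th row and \<open>\<theta>\<close> the centering.\<close>

definition Gamma_stat ::
    "(real \<Rightarrow> real \<Rightarrow> real) \<Rightarrow> real \<Rightarrow> (nat \<Rightarrow> nat \<Rightarrow> 'a \<Rightarrow> real) \<Rightarrow>
     nat \<Rightarrow> nat \<Rightarrow> 'a \<Rightarrow> real" where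
  "Gamma_stat h \<theta> X m k \<omega> =
     1 / real m * (\<Sum>i=1..m. \<Sum>j=m+1..m+k. h (X m i \<omega>) (X m j \<omega>) - \<theta>)"

definition cusum where
  "cusum h \<theta> X m k \<omega> = Gamma_stat h \<theta> X m k \<omega>"

definition modified_mosum where
  "modified_mosum b h \<theta> X m k \<omega> =
     Gamma_stat h \<theta> X m k \<omega> - Gamma_stat h \<theta> X m (nat \<lfloor>real k * b\<rfloor>) \<omega>"

definition page_cusum where
  "page_cusum h \<theta> X m k \<omega> =
     (SUP l\<in>{0..k}. \<bar>Gamma_stat h \<theta> X m k \<omega> - Gamma_stat h \<theta> X m l \<omega>\<bar>)"

definition monitoring_sup ::
    "(nat \<Rightarrow> nat \<Rightarrow> real) \<Rightarrow> (nat \<Rightarrow> nat \<Rightarrow> 'a \<Rightarrow> real) \<Rightarrow> nat \<Rightarrow> 'a \<Rightarrow> ereal" where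
  "monitoring_sup w \<Psi> m \<omega> = (SUP k\<in>{1..}. ereal (w m k * \<bar>\<Psi> m k \<omega>\<bar>))"

section \<open>Conditions (W), (R) and (A)\<close>

definition weight_conditions ::
    "(nat \<Rightarrow> nat \<Rightarrow> real) \<Rightarrow> (real \<Rightarrow> real) \<Rightarrow> real \<Rightarrow> bool" where
  "weight_conditions w \<rho> \<gamma> \<longleftrightarrow>
     (\<exists>l :: nat \<Rightarrow> real. (\<lambda>m. l m / real m) \<longlonglongrightarrow> 0 \<and>
        (\<forall>m\<ge>1. \<forall>k\<ge>1. w m k =
           real m powr (- 1 / 2) * (if real k > l m then \<rho> (real k / real m) else 0))) \<and>
     (\<forall>t>0. \<rho> t > 0) \<and> continuous_on {0<..} \<rho> \<and>
     0 \<le> \<gamma> \<and> \<gamma> < 1 / 2 \<and> (\<exists>L. ((\<lambda>t. t powr \<gamma> * \<rho> t) \<longlongrightarrow> L) (at_right 0)) \<and>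
     (\<exists>L. ((\<lambda>t. t * \<rho> t) \<longlongrightarrow> L) at_top)"

definition R_moment where
  "R_moment M h (Y :: int \<Rightarrow> 'a \<Rightarrow> real) \<gamma> \<longleftrightarrow>
     (\<exists>u :: nat \<Rightarrow> real.
        (\<forall>m\<ge>1. \<forall>k1 k2. m + 1 \<le> k1 \<longrightarrow> k1 \<le> k2 \<longrightarrow>
           (let S = (\<lambda>\<omega>. \<bar>\<Sum>i=1..m. \<Sum>j=k1..k2.
                        remainder M h Y (Y (int i) \<omega>) (Y (int j) \<omega>)\<bar>\<^sup>2)
            in integrable M S \<and>
               (\<integral>\<omega>. S \<omega> \<partial>M) \<le> u m * (real k2 - real k1 + 1))) \<and>
        (\<lambda>m. u m / real m powr (2 - 2 * \<gamma>) * (ln (real m))\<^sup>2) \<longlonglongrightarrow> 0)"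

definition R_fclt where
  "R_fclt M h (Y :: int \<Rightarrow> 'a \<Rightarrow> real) N W \<longleftrightarrow>
     integrable M (\<lambda>\<omega>. (h1 M h Y (Y 0 \<omega>))\<^sup>2) \<and>
     integrable M (\<lambda>\<omega>. (h2 M h Y (Y 0 \<omega>))\<^sup>2) \<and>
     (\<exists>s11 s12 s22.
        ((\<lambda>n. covar M (\<lambda>\<omega>. h1 M h Y (Y 0 \<omega>)) (\<lambda>\<omega>. h1 M h Y (Y n \<omega>))) has_sum s11) UNIV \<and>
        ((\<lambda>n. covar M (\<lambda>\<omega>. h2 M h Y (Y 0 \<omega>)) (\<lambda>\<omega>. h2 M h Y (Y n \<omega>))) has_sum s22) UNIV \<and>
        bivariate_wiener N W s11 s12 s22) \<and>
     (\<forall>T>0. weakly_converges_D T M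
        (\<lambda>m t \<omega>. (1 / sqrt (real m)) *\<^sub>R
           (\<Sum>i=1..\<lfloor>real m * t\<rfloor>. (h1 M h Y (Y i \<omega>), h2 M h Y (Y i \<omega>)))) N W)"

definition R_maximal where
  "R_maximal M h (Y :: int \<Rightarrow> 'a \<Rightarrow> real) \<longleftrightarrow>
     (\<forall>\<alpha>. 0 \<le> \<alpha> \<longrightarrow> \<alpha> < 1 / 2 \<longrightarrow>
        bigO_P M (\<lambda>m \<omega>. SUP k\<in>{1..m}.
          ereal (1 / (real m powr (1 / 2 - \<alpha>) * real k powr \<alpha>) *
                 \<bar>\<Sum>j=1..k. h2 M h Y (Y (int j) \<omega>)\<bar>)) (\<lambda>_. 1))"

definition R_tail where
  "R_tail M h (Y :: int \<Rightarrow> 'a \<Rightarrow> real) \<longleftrightarrow>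
     (\<forall>\<kappa> :: nat \<Rightarrow> nat. (\<forall>m. \<kappa> m > 0) \<longrightarrow> filterlim \<kappa> at_top sequentially \<longrightarrow>
        bigO_P M (\<lambda>m \<omega>. SUP k\<in>{\<kappa> m..}.
          ereal (1 / real k * \<bar>\<Sum>j=1..k. h2 M h Y (Y (int j) \<omega>)\<bar>))
          (\<lambda>m. 1 / sqrt (real (\<kappa> m))))"

definition R_conditions where
  "R_conditions M h Y \<gamma> N W \<longleftrightarrow>
     R_moment M h Y \<gamma> \<and> R_fclt M h Y N W \<and> R_maximal M h Y \<and> R_tail M h Y"

definition A_conditions where
  "A_conditions M h (Y :: int \<Rightarrow> 'a \<Rightarrow> real) (Z :: nat \<Rightarrow> int \<Rightarrow> 'a \<Rightarrow> real)
       (kstar :: nat \<Rightarrow> nat) \<longleftrightarrow>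
     (\<forall>k1 k2 :: nat \<Rightarrow> nat. (\<forall>m. 1 \<le> k1 m \<and> k1 m \<le> k2 m) \<longrightarrow>
        bigO_P M (\<lambda>m \<omega>. ereal (\<Sum>i=1..m. \<Sum>j=k1 m..k2 m.
            remainder_star M h Y Z m (Y (int i) \<omega>) (Z m (int j) \<omega>)))
          (\<lambda>m. sqrt (real m * (real (k2 m) - real (k1 m) + 1) *
                     max (real m) (real (k2 m) - real (k1 m) + 1)))) \<and>
     bigO_P M (\<lambda>m \<omega>. ereal (1 / sqrt (real m) *
         (\<Sum>i=1..m. h1_star M h Y Z m (Y (int i) \<omega>)))) (\<lambda>_. 1) \<and>
     (\<forall>\<kappa> :: nat \<Rightarrow> nat. filterlim \<kappa> at_top sequentially \<longrightarrow>
        bigO_P M (\<lambda>m \<omega>. ereal (1 / sqrt (real (\<kappa> m)) *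
          (\<Sum>j=m + kstar m + 1..m + kstar m + \<kappa> m. h2_star M h Y Z m (Z m (int j) \<omega>))))
          (\<lambda>_. 1))"

end

theory Submission
  imports Defs
begin

text \<open>Evaluate the supremum at the single monitoring time \<open>k = K (k\<^sup>* + m + 1)\<close> with a constant
  \<open>K \<ge> 2 / b\<close>. There \<open>(k/m) \<rho>(k/m)\<close> stays above some \<open>c > 0\<close>: in the bounded regime because \<open>k/m\<close>
  runs in a compact subset of \<open>(0, \<infinity>)\<close>, and otherwise by the lower bound on \<open>t \<rho>(t)\<close> at infinity. Hence
  \<open>w(m, k) \<ge> c \<surd>m / k\<close> eventually. The Hoeffding decompositions split \<open>\<Gamma>(m, k)\<close> into the
  signal \<open>(k - k\<^sup>*) \<Delta>\<^sub>m\<close> and six error terms, each of which is stochastically bounded after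
  multiplication by \<open>\<surd>m / k\<close>, whereas the signal contributes a positive multiple of
  \<open>\<surd>m \<bar>\<Delta>\<^sub>m\<bar>\<close>. For the modified MOSUM, \<open>K b \<ge> 2\<close> puts \<open>\<lfloor>k b\<rfloor>\<close> past the change point as well, so the
  same splitting applies to both terms, and the signal of the difference is \<open>(k - \<lfloor>k b\<rfloor>) \<Delta>\<^sub>m\<close>.\<close>

section \<open>Stochastic boundedness and divergence in probability\<close>

text \<open>The exceptional set is existentially quantified, so that sums and domination need no
  measurability of \<open>X\<close>.\<close>

definition stoch_bounded :: "'a measure \<Rightarrow> (nat \<Rightarrow> 'a \<Rightarrow> real) \<Rightarrow> bool" where
  "stoch_bounded M X \<longleftrightarrow>
     (\<forall>\<epsilon>>0. \<exists>C. \<forall>\<^sub>F m in sequentially. \<exists>B\<in>sets M.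
        measure M B < \<epsilon> \<and> (\<forall>\<omega>\<in>space M - B. \<bar>X m \<omega>\<bar> \<le> C))"

lemma stoch_bounded_mono:
  assumes "stoch_bounded M X"
    and "\<forall>\<^sub>F m in sequentially. \<forall>\<omega>\<in>space M. \<bar>V m \<omega>\<bar> \<le> \<bar>X m \<omega>\<bar>"
  shows "stoch_bounded M V"
  unfolding stoch_bounded_def
proof (intro allI impI)
  fix \<epsilon> :: real assume "\<epsilon> > 0"
  then obtain C where "\<forall>\<^sub>F m in sequentially. \<exists>B\<in>sets M.
        measure M B < \<epsilon> \<and> (\<forall>\<omega>\<in>space M - B. \<bar>X m \<omega>\<bar> \<le> C)"
    using assms(1) unfolding stoch_bounded_def by blast
  with assms(2) have "\<forall>\<^sub>F m in sequentially. \<exists>B\<in>sets M.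
        measure M B < \<epsilon> \<and> (\<forall>\<omega>\<in>space M - B. \<bar>V m \<omega>\<bar> \<le> C)"
    by eventually_elim (meson DiffD1 order_trans)
  then show "\<exists>C. \<forall>\<^sub>F m in sequentially. \<exists>B\<in>sets M.
        measure M B < \<epsilon> \<and> (\<forall>\<omega>\<in>space M - B. \<bar>V m \<omega>\<bar> \<le> C)"
    by blast
qed

lemma stoch_bounded_add:
  assumes "stoch_bounded M X" "stoch_bounded M V"
  shows "stoch_bounded M (\<lambda>m \<omega>. X m \<omega> + V m \<omega>)"
  unfolding stoch_bounded_def
proof (intro allI impI)
  fix \<epsilon> :: real assume "\<epsilon> > 0"
  then have half: "\<epsilon> / 2 > 0" by simp
  from assms(1) half obtain C where C: "\<forall>\<^sub>F m in sequentially. \<exists>B\<in>sets M.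
        measure M B < \<epsilon> / 2 \<and> (\<forall>\<omega>\<in>space M - B. \<bar>X m \<omega>\<bar> \<le> C)"
    unfolding stoch_bounded_def by blast
  from assms(2) half obtain D where D: "\<forall>\<^sub>F m in sequentially. \<exists>B\<in>sets M.
        measure M B < \<epsilon> / 2 \<and> (\<forall>\<omega>\<in>space M - B. \<bar>V m \<omega>\<bar> \<le> D)"
    unfolding stoch_bounded_def by blast
  from C D have "\<forall>\<^sub>F m in sequentially. \<exists>B\<in>sets M.
        measure M B < \<epsilon> \<and> (\<forall>\<omega>\<in>space M - B. \<bar>X m \<omega> + V m \<omega>\<bar> \<le> C + D)"
  proof eventually_elim
    case (elim m)
    then obtain A B where A: "A \<in> sets M" "measure M A < \<epsilon> / 2" "\<forall>\<omega>\<in>space M - A. \<bar>X m \<omega>\<bar> \<le> C"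
      and B: "B \<in> sets M" "measure M B < \<epsilon> / 2" "\<forall>\<omega>\<in>space M - B. \<bar>V m \<omega>\<bar> \<le> D"
      by blast
    have "measure M (A \<union> B) \<le> measure M A + measure M B"
      using A B by (intro measure_Un_le) auto
    then have "measure M (A \<union> B) < \<epsilon>"
      using A(2) B(2) by linarith
    moreover have "\<bar>X m \<omega> + V m \<omega>\<bar> \<le> C + D" if "\<omega> \<in> space M - (A \<union> B)" for \<omega>
    proof -
      have "\<bar>X m \<omega>\<bar> \<le> C" "\<bar>V m \<omega>\<bar> \<le> D"
        using A(3) B(3) that by auto
      then show ?thesis by linarith
    qed
    ultimately show ?case
      using A(1) B(1) by (intro bexI[of _ "A \<union> B"]) auto
  qed
  then show "\<exists>C. \<forall>\<^sub>F m in sequentially. \<exists>B\<in>sets M.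
        measure M B < \<epsilon> \<and> (\<forall>\<omega>\<in>space M - B. \<bar>X m \<omega> + V m \<omega>\<bar> \<le> C)"
    by blast
qed

text \<open>Passage from the \<open>bigO_P\<close> hypotheses. Measurability of \<open>X m\<close>
  makes the exceedance event an admissible exceptional set, and \<open>bound\<close> compares path
  by path, so \<open>X m\<close> may be a supremum that dominates the real quantity
  \<open>V m\<close>.\<close>

lemma stoch_bounded_bigO_P:
  assumes "bigO_P M X a"
    and "\<And>m. m \<ge> 1 \<Longrightarrow> X m \<in> borel_measurable M"
    and "\<And>m. 0 \<le> a m"
    and bound: "\<And>m \<omega> C. m \<ge> 1 \<Longrightarrow> \<omega> \<in> space M \<Longrightarrow> 0 \<le> C \<Longrightarrow>
           \<bar>X m \<omega>\<bar> \<le> ereal (C * a m) \<Longrightarrow> \<bar>V m \<omega>\<bar> \<le> K * C"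
  shows "stoch_bounded M V"
  unfolding stoch_bounded_def
proof (intro allI impI)
  fix \<epsilon> :: real assume "\<epsilon> > 0"
  then obtain C :: real where "\<forall>\<^sub>F m in sequentially.
        measure M {\<omega> \<in> space M. \<bar>X m \<omega>\<bar> > ereal (C * a m)} < \<epsilon>"
    using assms(1) unfolding bigO_P_def by blast
  with eventually_ge_at_top[of 1]
  have "\<forall>\<^sub>F m in sequentially. \<exists>B\<in>sets M.
        measure M B < \<epsilon> \<and> (\<forall>\<omega>\<in>space M - B. \<bar>V m \<omega>\<bar> \<le> K * \<bar>C\<bar>)"
  proof eventually_elim
    case (elim m)
    have [measurable]: "X m \<in> borel_measurable M" using assms(2) elim by simp
    \<comment> \<open>\<open>bigO_P\<close> may supply a negative constant, while
      \<open>bound\<close> asks for a nonnegative one; \<open>\<bar>C\<bar>\<close> serves because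
      \<open>a m\<close> is nonnegative.\<close>
    have "C * a m \<le> \<bar>C\<bar> * a m"
      using assms(3)[of m] by (simp add: mult_right_mono)
    then have le: "ereal (C * a m) \<le> ereal (\<bar>C\<bar> * a m)" by simp
    have "\<bar>V m \<omega>\<bar> \<le> K * \<bar>C\<bar>"
      if "\<omega> \<in> space M - {\<omega> \<in> space M. \<bar>X m \<omega>\<bar> > ereal (C * a m)}" for \<omega>
    proof (rule bound[OF elim(1)])
      have "\<bar>X m \<omega>\<bar> \<le> ereal (C * a m)" using that by (simp add: not_less)
      then show "\<bar>X m \<omega>\<bar> \<le> ereal (\<bar>C\<bar> * a m)" using le by (rule order_trans)
    qed (use that in auto)
    moreover have "{\<omega> \<in> space M. \<bar>X m \<omega>\<bar> > ereal (C * a m)} \<in> sets M"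
      by measurable
    ultimately show ?case using elim(2) by blast
  qed
  then show "\<exists>C. \<forall>\<^sub>F m in sequentially. \<exists>B\<in>sets M.
        measure M B < \<epsilon> \<and> (\<forall>\<omega>\<in>space M - B. \<bar>V m \<omega>\<bar> \<le> C)"
    by blast
qed

text \<open>Markov's inequality for the square: exceeding the level \<open>2 / \<epsilon>\<close>
  has probability at most \<open>\<epsilon> / 2\<close>, strictly below
  \<open>\<epsilon>\<close>.\<close>

lemma (in prob_space) stoch_bounded_L2:
  assumes int: "\<And>m. m \<ge> 1 \<Longrightarrow> integrable M (\<lambda>\<omega>. (X m \<omega>)\<^sup>2)"
    and bound: "\<forall>\<^sub>F m in sequentially. (\<integral>\<omega>. (X m \<omega>)\<^sup>2 \<partial>M) \<le> 1"
  shows "stoch_bounded M X"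
  unfolding stoch_bounded_def
proof (intro allI impI)
  fix \<epsilon> :: real assume \<epsilon>: "\<epsilon> > 0"
  from bound eventually_ge_at_top[of 1]
  have "\<forall>\<^sub>F m in sequentially. \<exists>B\<in>sets M.
        measure M B < \<epsilon> \<and> (\<forall>\<omega>\<in>space M - B. \<bar>X m \<omega>\<bar> \<le> sqrt (2 / \<epsilon>))"
  proof eventually_elim
    case (elim m)
    define B where "B = {\<omega> \<in> space M. (X m \<omega>)\<^sup>2 \<ge> 2 / \<epsilon>}"
    have [measurable]: "(\<lambda>\<omega>. (X m \<omega>)\<^sup>2) \<in> borel_measurable M"
      using int[OF elim(2)] by simp
    have "measure M B \<le> (\<integral>\<omega>. (X m \<omega>)\<^sup>2 \<partial>M) / (2 / \<epsilon>)"
      unfolding B_def using int[OF elim(2)] \<epsilon> by (intro integral_Markov_inequality_measure[where A="{}"]) auto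
    also have "\<dots> \<le> 1 / (2 / \<epsilon>)"
      using elim \<epsilon> by (intro divide_right_mono) auto
    also have "\<dots> < \<epsilon>" using \<epsilon> by simp
    finally have "measure M B < \<epsilon>" .
    moreover have "B \<in> sets M" unfolding B_def by measurable
    moreover have "\<bar>X m \<omega>\<bar> \<le> sqrt (2 / \<epsilon>)" if "\<omega> \<in> space M - B" for \<omega>
      using that by (intro real_le_rsqrt) (auto simp: B_def)
    ultimately show ?case by blast
  qed
  then show "\<exists>C. \<forall>\<^sub>F m in sequentially. \<exists>B\<in>sets M.
        measure M B < \<epsilon> \<and> (\<forall>\<omega>\<in>space M - B. \<bar>X m \<omega>\<bar> \<le> C)"
    by blast
qed

text \<open>A diverging deterministic signal beats bounded noise: off a set of mass below
  \<open>1 - y\<close> the noise is at most \<open>D\<close>, and once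
  \<open>a m > C / c + D\<close> the lower bound exceeds \<open>C\<close>.\<close>

lemma (in prob_space) tendsto_infinity_in_probI:
  assumes meas: "\<And>m. m \<ge> 1 \<Longrightarrow> X m \<in> borel_measurable M"
    and sb: "stoch_bounded M V"
    and sig: "filterlim a at_top sequentially" and "c > 0"
    and lower: "\<forall>\<^sub>F m in sequentially. \<forall>\<omega>\<in>space M. X m \<omega> \<ge> ereal (c * (a m - \<bar>V m \<omega>\<bar>))"
  shows "tendsto_infinity_in_prob M X"
  unfolding tendsto_infinity_in_prob_def
proof
  fix C :: real
  show "(\<lambda>m. measure M {\<omega> \<in> space M. X m \<omega> > ereal C}) \<longlonglongrightarrow> 1"
  proof (rule order_tendstoI)
    fix y :: real assume "y > 1"
    then show "\<forall>\<^sub>F m in sequentially. measure M {\<omega> \<in> space M. X m \<omega> > ereal C} < y"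
      using prob_le_1 by (intro always_eventually allI) (rule le_less_trans)
  next
    fix y :: real assume "y < 1"
    then obtain D where D: "\<forall>\<^sub>F m in sequentially. \<exists>B\<in>sets M.
        measure M B < 1 - y \<and> (\<forall>\<omega>\<in>space M - B. \<bar>V m \<omega>\<bar> \<le> D)"
      using sb[unfolded stoch_bounded_def, rule_format, of "1 - y"] by auto
    from sig have "\<forall>\<^sub>F m in sequentially. a m > C / c + D"
      by (simp add: filterlim_at_top_dense)
    with D lower eventually_ge_at_top[of 1]
    show "\<forall>\<^sub>F m in sequentially. y < measure M {\<omega> \<in> space M. X m \<omega> > ereal C}"
    proof eventually_elim
      case (elim m)
      then obtain B where B: "B \<in> sets M" "measure M B < 1 - y" "\<forall>\<omega>\<in>space M - B. \<bar>V m \<omega>\<bar> \<le> D"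
        by blast
      have [measurable]: "X m \<in> borel_measurable M" using meas elim by simp
      have "X m \<omega> > ereal C" if "\<omega> \<in> space M - B" for \<omega>
      proof -
        have "\<bar>V m \<omega>\<bar> \<le> D" using B(3) that by blast
        with elim have "C / c < a m - \<bar>V m \<omega>\<bar>" by linarith
        then have "C < c * (a m - \<bar>V m \<omega>\<bar>)"
          using \<open>c > 0\<close> by (simp add: pos_divide_less_eq mult.commute)
        then have "ereal C < ereal (c * (a m - \<bar>V m \<omega>\<bar>))" by simp
        also have "\<dots> \<le> X m \<omega>" using elim(2) that by blast
        finally show ?thesis .
      qed
      then have "measure M (space M - B) \<le> measure M {\<omega> \<in> space M. X m \<omega> > ereal C}"
        by (intro finite_measure_mono) auto
      then show ?case using B prob_compl[of B] by simp
    qed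
  qed
qed

section \<open>Evaluation at the right end point in the Skorokhod space\<close>

text \<open>One-sided limits bound the path on a punctured neighbourhood of each point, adding the
  point itself changes nothing, and compactness of \<open>{0..T}\<close> leaves finitely many
  neighbourhoods.\<close>

lemma cadlag_bounded:
  fixes x :: "real \<Rightarrow> 'b::metric_space"
  assumes "cadlag T x"
  shows "bounded (x ` {0..T})"
proof -
  have "\<exists>U. open U \<and> t \<in> U \<and> bounded (x ` (U \<inter> {0..T}))" if t: "t \<in> {0..T}" for t
  proof -
    have "\<exists>b>t. bounded (x ` ({t<..<b} \<inter> {0..T}))"
    proof (cases "t < T")
      case True
      then have "(x \<longlongrightarrow> x t) (at_right t)" using assms t by (auto simp: cadlag_def)
      then have "\<forall>\<^sub>F s in at_right t. dist (x s) (x t) < 1"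
        by (rule tendstoD) simp
      then obtain b where "b > t" "\<forall>s>t. s < b \<longrightarrow> dist (x s) (x t) < 1"
        by (auto simp: eventually_at_right_field)
      then have "x ` ({t<..<b} \<inter> {0..T}) \<subseteq> ball (x t) 1"
        by (auto simp: dist_commute)
      then show ?thesis using \<open>b > t\<close> bounded_subset[OF bounded_ball] by blast
    next
      case False
      \<comment> \<open>At \<open>t = T\<close> there is no right limit to exploit, but a right
        neighbourhood misses \<open>{0..T}\<close>. The left side is treated in the same way at
        \<open>t = 0\<close>.\<close>
      then have "{t<..<t + 1} \<inter> {0..T} = {}" using t by auto
      then show ?thesis by (intro exI[of _ "t + 1"]) simp
    qed
    then obtain b where b: "b > t" "bounded (x ` ({t<..<b} \<inter> {0..T}))" by blast
    have "\<exists>a<t. bounded (x ` ({a<..<t} \<inter> {0..T}))"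
    proof (cases "0 < t")
      case True
      then obtain l where "(x \<longlongrightarrow> l) (at_left t)" using assms t unfolding cadlag_def by force
      then have "\<forall>\<^sub>F s in at_left t. dist (x s) l < 1"
        by (rule tendstoD) simp
      then obtain a where "a < t" "\<forall>s>a. s < t \<longrightarrow> dist (x s) l < 1"
        by (auto simp: eventually_at_left_field)
      then have "x ` ({a<..<t} \<inter> {0..T}) \<subseteq> ball l 1"
        by (auto simp: dist_commute)
      then show ?thesis using \<open>a < t\<close> bounded_subset[OF bounded_ball] by blast
    next
      case False
      then have "{t - 1<..<t} \<inter> {0..T} = {}" using t by auto
      then show ?thesis by (intro exI[of _ "t - 1"]) simp
    qed
    then obtain a where a: "a < t" "bounded (x ` ({a<..<t} \<inter> {0..T}))" by blast
    have "{a<..<b} \<inter> {0..T} \<subseteq> {a<..<t} \<inter> {0..T} \<union> {t} \<union> {t<..<b} \<inter> {0..T}"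
      by auto
    from image_mono[OF this, of x] have "x ` ({a<..<b} \<inter> {0..T}) \<subseteq>
        x ` ({a<..<t} \<inter> {0..T}) \<union> {x t} \<union> x ` ({t<..<b} \<inter> {0..T})"
      unfolding image_Un by simp
    moreover have "bounded (x ` ({a<..<t} \<inter> {0..T}) \<union> {x t} \<union> x ` ({t<..<b} \<inter> {0..T}))"
      using a(2) b(2) by simp
    ultimately have "bounded (x ` ({a<..<b} \<inter> {0..T}))"
      by (rule bounded_subset[rotated])
    then show ?thesis using a b by (intro exI[of _ "{a<..<b}"]) auto
  qed
  then obtain U where U: "\<And>t. t \<in> {0..T} \<Longrightarrow> open (U t) \<and> t \<in> U t \<and> bounded (x ` (U t \<inter> {0..T}))"
    by metis
  obtain C where C: "C \<subseteq> {0..T}" "finite C" "{0..T} \<subseteq> (\<Union>t\<in>C. U t)"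
  proof (rule compactE_image[of "{0..T}" "{0..T}" U])
    show "{0..T} \<subseteq> (\<Union>t\<in>{0..T}. U t)" using U by blast
  qed (use U in auto)
  then have "x ` {0..T} \<subseteq> (\<Union>t\<in>C. x ` (U t \<inter> {0..T}))" by blast
  moreover have "bounded (\<Union>t\<in>C. x ` (U t \<inter> {0..T}))"
    using C U by (intro bounded_UN) auto
  ultimately show ?thesis by (rule bounded_subset[rotated])
qed

text \<open>By surjectivity \<open>T\<close> has a preimage \<open>s \<le> T\<close>, and
  monotonicity gives \<open>T = \<tau> s \<le> \<tau> T \<le> T\<close>.\<close>

lemma time_change_end:
  assumes "time_change T \<tau>" "0 \<le> T"
  shows "\<tau> T = T"
proof -
  have im: "\<tau> ` {0..T} = {0..T}" and mono: "strict_mono_on {0..T} \<tau>"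
    using assms(1) by (auto simp: time_change_def)
  have "T \<in> \<tau> ` {0..T}" "\<tau> T \<in> {0..T}" using im assms(2) by auto
  then obtain s where s: "s \<in> {0..T}" "\<tau> s = T" by (metis imageE)
  have "\<tau> s \<le> \<tau> T" using mono s(1) assms(2) strict_mono_on_leD[OF mono, of s T] by auto
  then show ?thesis using s \<open>\<tau> T \<in> {0..T}\<close> by simp
qed

text \<open>Every time change fixes \<open>T\<close>, so each admissible \<open>e\<close> already
  bounds the distance of the end values. This makes evaluation at \<open>T\<close>
  Lipschitz.\<close>

lemma dist_end_le_skorokhod_dist:
  assumes "cadlag T x" "cadlag T y" "0 \<le> T"
  shows "dist (x T) (y T) \<le> skorokhod_dist T x y"
  unfolding skorokhod_dist_def
proof (rule cInf_greatest)
  \<comment> \<open>A bound on the diameter of the union of both ranges is admissible with the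
    identity as time change. Nonemptiness matters, because \<open>Inf\<close> of the empty set
    carries no information.\<close>
  obtain e where e: "\<And>p q. p \<in> x ` {0..T} \<union> y ` {0..T} \<Longrightarrow> q \<in> x ` {0..T} \<union> y ` {0..T} \<Longrightarrow> dist p q \<le> e"
    using cadlag_bounded[OF assms(1)] cadlag_bounded[OF assms(2)]
    by (metis bounded_Un bounded_two_points)
  have "dist (x T) (x T) \<le> e" using assms(3) by (intro e) auto
  then have "0 \<le> e" by simp
  moreover have "time_change T id" by (auto simp: time_change_def strict_mono_on_def)
  moreover have "\<forall>t\<in>{0..T}. \<bar>id t - t\<bar> \<le> e \<and> dist (x t) (y (id t)) \<le> e"
    using \<open>0 \<le> e\<close> e by auto
  ultimately show "{e. 0 \<le> e \<and> (\<exists>\<tau>. time_change T \<tau> \<and>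
            (\<forall>t\<in>{0..T}. \<bar>\<tau> t - t\<bar> \<le> e \<and> dist (x t) (y (\<tau> t)) \<le> e))} \<noteq> {}"
    by blast
next
  fix e assume "e \<in> {e. 0 \<le> e \<and> (\<exists>\<tau>. time_change T \<tau> \<and>
            (\<forall>t\<in>{0..T}. \<bar>\<tau> t - t\<bar> \<le> e \<and> dist (x t) (y (\<tau> t)) \<le> e))}"
  then obtain \<tau> where "time_change T \<tau>" "dist (x T) (y (\<tau> T)) \<le> e"
    using assms(3) by auto
  then show "dist (x T) (y T) \<le> e" using time_change_end assms(3) by metis
qed

text \<open>Tightness of the end values. A level \<open>n\<close> is chosen at which the limit has
  small tail expectation; weak convergence carries this over to \<open>S m T\<close> for large
  \<open>m\<close>, and Markov's inequality turns it into a probability.\<close>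

lemma weakly_converges_D_stoch_bounded_end:
  fixes S :: "nat \<Rightarrow> real \<Rightarrow> 'a \<Rightarrow> 'b::real_normed_vector" and W :: "real \<Rightarrow> 'c \<Rightarrow> 'b"
  assumes conv: "weakly_converges_D T M S N W" and "0 \<le> T"
    and "prob_space M" "prob_space N"
    and [measurable]: "\<And>m. S m T \<in> borel_measurable M" "W T \<in> borel_measurable N"
  shows "stoch_bounded M (\<lambda>m \<omega>. norm (S m T \<omega>))"
  unfolding stoch_bounded_def
proof (intro allI impI)
  fix \<epsilon> :: real assume \<epsilon>: "\<epsilon> > 0"
  interpret M: prob_space M by fact
  interpret N: prob_space N by fact
  \<comment> \<open>Evaluation at the right end point \<open>T\<close> is continuous for the Skorokhod metric, because time
    changes fix \<open>T\<close>; \<open>G\<close> is a Lipschitz substitute for the indicator of \<open>norm v > C\<close>.\<close>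
  define G where "G C v = min 1 (max 0 (norm v - C))" for C :: real and v :: 'b
  have G01: "0 \<le> G C v" "G C v \<le> 1" for C v by (auto simp: G_def)
  have G_dist: "\<bar>G C u - G C v\<bar> \<le> dist u v" for C u v
    using norm_triangle_ineq3[of u v] by (auto simp: G_def dist_norm min_def max_def)
  have [measurable]: "G C \<in> borel_measurable borel" for C unfolding G_def by measurable
  have "(\<lambda>n. \<integral>\<omega>. G (real n) (W T \<omega>) \<partial>N) \<longlonglongrightarrow> (\<integral>\<omega>. 0 \<partial>N)"
  proof (rule integral_dominated_convergence[where w="\<lambda>_. 1"])
    show "AE \<omega> in N. (\<lambda>n. G (real n) (W T \<omega>)) \<longlonglongrightarrow> 0"
    proof (intro AE_I2 tendsto_eventually)
      fix \<omega>
      show "\<forall>\<^sub>F n in sequentially. G (real n) (W T \<omega>) = 0"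
        using eventually_ge_at_top[of "nat \<lceil>norm (W T \<omega>)\<rceil>"]
      proof eventually_elim
        case (elim n)
        then have "norm (W T \<omega>) \<le> real n" by linarith
        then show ?case by (simp add: G_def)
      qed
    qed
  qed (use G01 in auto)
  then have "\<forall>\<^sub>F n in sequentially. (\<integral>\<omega>. G (real n) (W T \<omega>) \<partial>N) < \<epsilon>"
    using \<epsilon> by (intro order_tendstoD(2)) auto
  then obtain n where n: "(\<integral>\<omega>. G (real n) (W T \<omega>) \<partial>N) < \<epsilon>"
    by (auto simp: eventually_sequentially)
  have "skorokhod_continuous T (\<lambda>x. G (real n) (x T))"
    unfolding skorokhod_continuous_def
  proof (intro allI impI)
    fix x :: "real \<Rightarrow> 'b" and e :: real assume "cadlag T x" "e > 0"
    moreover have "\<bar>G (real n) (y T) - G (real n) (x T)\<bar> < e"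
      if "cadlag T y" "skorokhod_dist T x y < e" for y
      using G_dist[of n "y T" "x T"] dist_end_le_skorokhod_dist[OF \<open>cadlag T x\<close> that(1) \<open>0 \<le> T\<close>] that(2)
      by (simp add: dist_commute)
    ultimately show "\<exists>d>0. \<forall>y. cadlag T y \<longrightarrow> skorokhod_dist T x y < d \<longrightarrow>
        \<bar>G (real n) (y T) - G (real n) (x T)\<bar> < e" by blast
  qed
  moreover have "\<exists>B. \<forall>x. cadlag T x \<longrightarrow> \<bar>G (real n) (x T)\<bar> \<le> B"
    using G01 by (metis abs_of_nonneg)
  ultimately have "(\<lambda>m. \<integral>\<omega>. G (real n) (S m T \<omega>) \<partial>M) \<longlonglongrightarrow> (\<integral>\<omega>. G (real n) (W T \<omega>) \<partial>N)"
    using conv[unfolded weakly_converges_D_def, rule_format, of "\<lambda>x. G (real n) (x T)"] by blast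
  then have "\<forall>\<^sub>F m in sequentially. (\<integral>\<omega>. G (real n) (S m T \<omega>) \<partial>M) < \<epsilon>"
    using n by (intro order_tendstoD(2)) auto
  then have "\<forall>\<^sub>F m in sequentially. \<exists>B\<in>sets M.
        measure M B < \<epsilon> \<and> (\<forall>\<omega>\<in>space M - B. \<bar>norm (S m T \<omega>)\<bar> \<le> real n + 1)"
  proof eventually_elim
    case (elim m)
    define B where "B = {\<omega> \<in> space M. G (real n) (S m T \<omega>) \<ge> 1}"
    have "integrable M (\<lambda>\<omega>. G (real n) (S m T \<omega>))"
      using G01 by (intro M.integrable_const_bound[where B=1]) auto
    then have "measure M B \<le> (\<integral>\<omega>. G (real n) (S m T \<omega>) \<partial>M) / 1"
      unfolding B_def using G01 by (intro integral_Markov_inequality_measure[where A="{}"]) auto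
    then have "measure M B < \<epsilon>" using elim by simp
    moreover have "B \<in> sets M" unfolding B_def by measurable
    \<comment> \<open>\<open>G (real n) v < 1\<close> means \<open>norm v < real n + 1\<close>,
      whence the constant.\<close>
    moreover have "\<bar>norm (S m T \<omega>)\<bar> \<le> real n + 1" if "\<omega> \<in> space M - B" for \<omega>
      using that by (auto simp: B_def G_def min_def max_def split: if_splits)
    ultimately show ?case by blast
  qed
  then show "\<exists>C. \<forall>\<^sub>F m in sequentially. \<exists>B\<in>sets M.
        measure M B < \<epsilon> \<and> (\<forall>\<omega>\<in>space M - B. \<bar>norm (S m T \<omega>)\<bar> \<le> C)"
    by blast
qed

section \<open>The change-point model and measurability\<close>

locale change_point_model = prob_space M for M :: "'a measure" +
  fixes N :: "'c measure" and h :: "real \<Rightarrow> real \<Rightarrow> real" and \<gamma> :: real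
    and Y :: "int \<Rightarrow> 'a \<Rightarrow> real" and Z :: "nat \<Rightarrow> int \<Rightarrow> 'a \<Rightarrow> real"
    and kstar :: "nat \<Rightarrow> nat" and W :: "real \<Rightarrow> 'c \<Rightarrow> real \<times> real"
  assumes measurable_kernel: "case_prod h \<in> borel_measurable borel"
    and measurable_Y [measurable]: "\<And>i. Y i \<in> borel_measurable M"
    and measurable_Z: "\<And>m i. m \<ge> 1 \<Longrightarrow> Z m i \<in> borel_measurable M"
    and gamma_nonneg: "0 \<le> \<gamma>"
    and R: "R_conditions M h Y \<gamma> N W"
    and A: "A_conditions M h Y Z kstar"
begin

abbreviation "X \<equiv> obs Y Z kstar"
abbreviation "\<theta> \<equiv> theta M h Y"
abbreviation "\<Delta> \<equiv> Delta M h Y Z"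

lemma measurable_kernel_app [measurable (raw)]:
  assumes "f \<in> borel_measurable L" "g \<in> borel_measurable L"
  shows "(\<lambda>x. h (f x) (g x)) \<in> borel_measurable L"
  using measurable_compose[OF borel_measurable_Pair[OF assms] measurable_kernel] by simp

lemma measurable_h1 [measurable]: "h1 M h Y \<in> borel_measurable borel"
  unfolding h1_def by measurable

lemma measurable_h2 [measurable]: "h2 M h Y \<in> borel_measurable borel"
  unfolding h2_def by measurable

lemma measurable_h1_star: "m \<ge> 1 \<Longrightarrow> h1_star M h Y Z m \<in> borel_measurable borel"
  using measurable_Z[of m 1, measurable] unfolding h1_star_def by measurable

lemma measurable_h2_star [measurable]: "h2_star M h Y Z m \<in> borel_measurable borel"
  unfolding h2_star_def by measurable

lemma measurable_remainder_star:
  assumes m: "m \<ge> 1"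
  shows "(\<lambda>\<omega>. remainder_star M h Y Z m (Y i \<omega>) (Z m j \<omega>)) \<in> borel_measurable M"
proof -
  note [measurable] = measurable_Z[OF m] measurable_h1_star[OF m]
  show ?thesis unfolding remainder_star_def by measurable
qed

lemma measurable_Gamma:
  assumes m: "m \<ge> 1"
  shows "Gamma_stat h \<theta> X m k \<in> borel_measurable M"
proof -
  note [measurable] = measurable_Z[OF m]
  have [measurable]: "X m i \<in> borel_measurable M" for i
    unfolding obs_def by (cases "i \<le> kstar m + m") simp_all
  show ?thesis unfolding Gamma_stat_def by measurable
qed

lemma measurable_monitoring_sup:
  assumes "\<And>k. \<Psi> m k \<in> borel_measurable M"
  shows "monitoring_sup w \<Psi> m \<in> borel_measurable M"
proof -
  note [measurable] = assms
  show ?thesis unfolding monitoring_sup_def by measurable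
qed

lemma measurable_page_cusum:
  assumes m: "m \<ge> 1"
  shows "page_cusum h \<theta> X m k \<in> borel_measurable M"
proof -
  note [measurable] = measurable_Gamma[OF m]
  show ?thesis unfolding page_cusum_def by measurable
qed

section \<open>Stochastic bounds for the error terms\<close>

text \<open>The functional central limit theorem evaluated at time \<open>1\<close>, where the path
  is the normalised sum over \<open>1..m\<close>. The first coordinate is dominated by the norm of
  the pair.\<close>

lemma stoch_bounded_h1:
  "stoch_bounded M (\<lambda>m \<omega>. 1 / sqrt (real m) * (\<Sum>i=1..m. h1 M h Y (Y (int i) \<omega>)))"
proof -
  define S :: "nat \<Rightarrow> real \<Rightarrow> 'a \<Rightarrow> real \<times> real" where
    "S m t \<omega> = (1 / sqrt (real m)) *\<^sub>R
           (\<Sum>i=1..\<lfloor>real m * t\<rfloor>. (h1 M h Y (Y i \<omega>), h2 M h Y (Y i \<omega>)))" for m t \<omega>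
  have fclt: "R_fclt M h Y N W" using R by (simp add: R_conditions_def)
  then have "prob_space N" "W 1 \<in> borel_measurable N"
    by (auto simp: R_fclt_def bivariate_wiener_def)
  moreover have "weakly_converges_D 1 M S N W"
    using fclt by (auto simp: R_fclt_def S_def[abs_def])
  moreover have "S m 1 \<in> borel_measurable M" for m
    unfolding S_def by measurable
  ultimately have "stoch_bounded M (\<lambda>m \<omega>. norm (S m 1 \<omega>))"
    using prob_space_axioms by (intro weakly_converges_D_stoch_bounded_end) auto
  then show ?thesis
  proof (rule stoch_bounded_mono, intro always_eventually allI ballI)
    fix m \<omega>
    have "(\<Sum>i=1..int m. h1 M h Y (Y i \<omega>)) = (\<Sum>i=1..m. h1 M h Y (Y (int i) \<omega>))"
      by (rule sum.reindex_bij_witness[of _ int nat]) auto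
    then have "fst (S m 1 \<omega>) = 1 / sqrt (real m) * (\<Sum>i=1..m. h1 M h Y (Y (int i) \<omega>))"
      by (simp add: S_def fst_sum)
    then show "\<bar>1 / sqrt (real m) * (\<Sum>i=1..m. h1 M h Y (Y (int i) \<omega>))\<bar> \<le> \<bar>norm (S m 1 \<omega>)\<bar>"
      using norm_fst_le[of "fst (S m 1 \<omega>)" "snd (S m 1 \<omega>)"] by (metis abs_ge_self order_trans prod.collapse real_norm_def)
  qed
qed

lemma stoch_bounded_h1_star:
  "stoch_bounded M (\<lambda>m \<omega>. 1 / sqrt (real m) * (\<Sum>i=1..m. h1_star M h Y Z m (Y (int i) \<omega>)))"
proof (rule stoch_bounded_bigO_P)
  show "bigO_P M (\<lambda>m \<omega>. ereal (1 / sqrt (real m) *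
         (\<Sum>i=1..m. h1_star M h Y Z m (Y (int i) \<omega>)))) (\<lambda>_. 1)"
    using A unfolding A_conditions_def by blast
  show "(\<lambda>\<omega>. ereal (1 / sqrt (real m) * (\<Sum>i=1..m. h1_star M h Y Z m (Y (int i) \<omega>))))
      \<in> borel_measurable M" if "m \<ge> 1" for m
    using measurable_h1_star[OF that, measurable] by measurable
  show "\<bar>1 / sqrt (real m) * Q\<bar> \<le> 1 * C"
    if "\<bar>ereal (1 / sqrt (real m) * Q)\<bar> \<le> ereal (C * 1)" for m C Q
    using that by simp
qed simp

text \<open>The evaluation time is kept abstract because the modified MOSUM requires the bounds at
  two times. The assumption gives more than \<open>m\<close> observations after the change, and
  \<open>k m\<close> dominates both \<open>m\<close> and \<open>kstar m\<close>.\<close>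

context
  fixes k :: "nat \<Rightarrow> nat"
  assumes k: "\<And>m. k m \<ge> kstar m + m + 1"
begin

text \<open>A second-moment bound. The growth condition and \<open>\<gamma> \<ge> 0\<close> yield
  \<open>u m \<le> m^2\<close> eventually, so the normalised second moment is at most
  \<open>(1 / (m * k^2)) * m^2 * k = m / k \<le> 1\<close>.\<close>

lemma stoch_bounded_remainder:
  "stoch_bounded M (\<lambda>m \<omega>. sqrt (real m) / real (k m) * (1 / real m *
     (\<Sum>i=1..m. \<Sum>j=m+1..m+kstar m. remainder M h Y (Y (int i) \<omega>) (Y (int j) \<omega>))))"
    (is "stoch_bounded M (\<lambda>m \<omega>. _ * (_ * ?Q m \<omega>))")
proof -
  obtain u :: "nat \<Rightarrow> real" where
    u: "\<And>m k1 k2. m \<ge> 1 \<Longrightarrow> m + 1 \<le> k1 \<Longrightarrow> k1 \<le> k2 \<Longrightarrow>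
           (let S = (\<lambda>\<omega>. \<bar>\<Sum>i=1..m. \<Sum>j=k1..k2.
                        remainder M h Y (Y (int i) \<omega>) (Y (int j) \<omega>)\<bar>\<^sup>2)
            in integrable M S \<and> (\<integral>\<omega>. S \<omega> \<partial>M) \<le> u m * (real k2 - real k1 + 1))"
    and lim: "(\<lambda>m. u m / real m powr (2 - 2 * \<gamma>) * (ln (real m))\<^sup>2) \<longlonglongrightarrow> 0"
    using R unfolding R_conditions_def R_moment_def by blast
  define c where "c m = sqrt (real m) / real (k m) * (1 / real m)" for m
  have int_le: "integrable M (\<lambda>\<omega>. (c m * ?Q m \<omega>)\<^sup>2) \<and>
      (\<integral>\<omega>. (c m * ?Q m \<omega>)\<^sup>2 \<partial>M) \<le> (c m)\<^sup>2 * (u m * real (kstar m))" if m: "m \<ge> 1" for m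
  \<comment> \<open>The moment condition covers nonempty ranges of \<open>j\<close> only; for
    \<open>kstar m = 0\<close> the inner sum is empty.\<close>
  proof (cases "kstar m = 0")
    case False
    then have "integrable M (\<lambda>\<omega>. (?Q m \<omega>)\<^sup>2)" "(\<integral>\<omega>. (?Q m \<omega>)\<^sup>2 \<partial>M) \<le> u m * real (kstar m)"
      using u[of m "m + 1" "m + kstar m"] m by (auto simp: Let_def)
    then show ?thesis by (simp add: power_mult_distrib mult_left_mono)
  qed simp
  have "\<forall>\<^sub>F m in sequentially. \<bar>u m / real m powr (2 - 2 * \<gamma>) * (ln (real m))\<^sup>2\<bar> < 1"
    using tendstoD[OF lim, of 1] by (simp add: dist_real_def)
  with eventually_ge_at_top[of 3]
  have "\<forall>\<^sub>F m in sequentially. (\<integral>\<omega>. (c m * ?Q m \<omega>)\<^sup>2 \<partial>M) \<le> 1"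
  proof eventually_elim
    case (elim m)
    define p where "p = real m powr (2 - 2 * \<gamma>)"
    have p: "0 < p" "p \<le> (real m)\<^sup>2"
    proof -
      show "0 < p" using elim by (simp add: p_def)
      have "p \<le> real m powr 2" unfolding p_def using elim gamma_nonneg by (intro powr_mono) auto
      then show "p \<le> (real m)\<^sup>2" using elim by (simp add: powr_numeral)
    qed
    have "1 \<le> ln (real m)"
      using elim(1) exp_le by (subst ln_ge_iff) (auto intro: order_trans)
    then have "1 \<le> (ln (real m))\<^sup>2" by (simp add: one_le_power)
    then have "\<bar>u m\<bar> / p * 1 \<le> \<bar>u m\<bar> / p * (ln (real m))\<^sup>2"
      using p by (intro mult_left_mono) auto
    also have "\<dots> < 1" using elim(2) p by (simp add: p_def abs_mult)
    finally have "u m < p" using p by (simp add: pos_divide_less_eq)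
    then have "u m \<le> (real m)\<^sup>2" using p by linarith
    have km: "real (kstar m) \<le> real (k m)" "real m \<le> real (k m)" "0 < real (k m)" "0 < real m"
      using k[of m] elim by auto
    have "(c m)\<^sup>2 * (u m * real (kstar m)) \<le> (c m)\<^sup>2 * ((real m)\<^sup>2 * real (k m))"
      using km \<open>u m \<le> _\<close> by (intro mult_left_mono mult_mono) auto
    also have "\<dots> = real m / real (k m)"
      using km by (simp add: c_def power_mult_distrib power_divide field_simps power2_eq_square)
    also have "\<dots> \<le> 1" using km by simp
    finally show ?case using int_le[of m] elim by simp
  qed
  then have "stoch_bounded M (\<lambda>m \<omega>. c m * ?Q m \<omega>)"
    using int_le by (intro stoch_bounded_L2) auto
  then show ?thesis by (simp add: c_def mult.assoc)
qed

text \<open>The range of \<open>j\<close> has \<open>n = k - kstar \<ge> m\<close> elements, so the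
  rate in the hypothesis simplifies to \<open>sqrt m * n\<close>. The prefactor
  \<open>1 / (sqrt m * k)\<close> reduces it to \<open>n / k \<le> 1\<close>.\<close>

lemma stoch_bounded_remainder_star:
  "stoch_bounded M (\<lambda>m \<omega>. sqrt (real m) / real (k m) * (1 / real m *
     (\<Sum>i=1..m. \<Sum>j=m+kstar m+1..m+k m. remainder_star M h Y Z m (Y (int i) \<omega>) (Z m (int j) \<omega>))))"
    (is "stoch_bounded M (\<lambda>m \<omega>. _ * (_ * ?Q m \<omega>))")
proof (rule stoch_bounded_bigO_P)
  let ?n = "\<lambda>m. real (m + k m) - real (m + kstar m + 1) + 1"
  have "\<forall>m. 1 \<le> m + kstar m + 1 \<and> m + kstar m + 1 \<le> m + k m"
  proof
    fix m show "1 \<le> m + kstar m + 1 \<and> m + kstar m + 1 \<le> m + k m" using k[of m] by auto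
  qed
  then show "bigO_P M (\<lambda>m \<omega>. ereal (?Q m \<omega>)) (\<lambda>m. sqrt (real m * ?n m * max (real m) (?n m)))"
    using A[unfolded A_conditions_def, THEN conjunct1, rule_format,
        of "\<lambda>m. m + kstar m + 1" "\<lambda>m. m + k m"] by blast
  show "(\<lambda>\<omega>. ereal (?Q m \<omega>)) \<in> borel_measurable M" if "m \<ge> 1" for m
    using measurable_remainder_star[OF that, measurable] by measurable
  show "0 \<le> sqrt (real m * ?n m * max (real m) (?n m))" for m
    using k[of m] by auto
  fix m \<omega> and C :: real
  assume m: "m \<ge> 1" and "C \<ge> 0"
    and le: "\<bar>ereal (?Q m \<omega>)\<bar> \<le> ereal (C * sqrt (real m * ?n m * max (real m) (?n m)))"
  define n where "n = ?n m"
  have n: "real m \<le> n" "n \<le> real (k m)" "0 < real m"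
    using k[of m] m by (auto simp: n_def)
  then have "\<bar>?Q m \<omega>\<bar> \<le> C * sqrt (real m * n * n)"
    using le[folded n_def] by (simp add: max_absorb2)
  also have "\<dots> = C * (sqrt (real m) * n)"
    using n by (simp add: real_sqrt_mult mult.assoc)
  finally have "sqrt (real m) / real (k m) * (1 / real m * \<bar>?Q m \<omega>\<bar>) \<le>
      sqrt (real m) / real (k m) * (1 / real m * (C * (sqrt (real m) * n)))"
    by (intro mult_left_mono) auto
  also have "\<dots> = C * (n / real (k m))"
    using n by (simp add: field_simps)
  also have "\<dots> \<le> C * 1"
    using n \<open>C \<ge> 0\<close> by (intro mult_left_mono) auto
  finally show "\<bar>sqrt (real m) / real (k m) * (1 / real m * ?Q m \<omega>)\<bar> \<le> 1 * C"
    by (simp add: abs_mult)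
qed

text \<open>The sum is a difference of two partial sums of lengths \<open>m + kstar m\<close> and
  \<open>m\<close>. Both lengths lie in the range \<open>p \<ge> m\<close> of the tail condition,
  which bounds each partial sum by \<open>p * C / sqrt m\<close>, and both are at most
  \<open>k m\<close>; this explains the factor \<open>2\<close>.\<close>

lemma stoch_bounded_h2_before:
  "stoch_bounded M (\<lambda>m \<omega>. sqrt (real m) / real (k m) * (\<Sum>j=m+1..m+kstar m. h2 M h Y (Y (int j) \<omega>)))"
proof (rule stoch_bounded_bigO_P)
  let ?S = "\<lambda>p \<omega>. \<Sum>j=1..p. h2 M h Y (Y (int j) \<omega>)"
  \<comment> \<open>The tail condition asks for a positive sequence, also at \<open>m = 0\<close>;
    hence \<open>max m 1\<close>.\<close>
  have "filterlim (\<lambda>m. max m 1 :: nat) at_top sequentially"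
    by (rule filterlim_at_top_mono[OF filterlim_ident]) auto
  then show "bigO_P M (\<lambda>m \<omega>. SUP p\<in>{max m 1..}. ereal (1 / real p * \<bar>?S p \<omega>\<bar>))
     (\<lambda>m. 1 / sqrt (real (max m 1)))"
    using R[unfolded R_conditions_def R_tail_def, THEN conjunct2, THEN conjunct2, THEN conjunct2,
      rule_format, of "\<lambda>m. max m 1"] by simp
  show "(\<lambda>\<omega>. SUP p\<in>{max m 1..}. ereal (1 / real p * \<bar>?S p \<omega>\<bar>)) \<in> borel_measurable M" for m
    by measurable
  show "0 \<le> 1 / sqrt (real (max m 1))" for m by simp
  fix m \<omega> and C :: real
  assume m: "m \<ge> 1" and "C \<ge> 0"
    and le: "\<bar>SUP p\<in>{max m 1..}. ereal (1 / real p * \<bar>?S p \<omega>\<bar>)\<bar> \<le> ereal (C * (1 / sqrt (real (max m 1))))"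
  have abs_ge: "x \<le> \<bar>x\<bar>" for x :: ereal by (cases x) auto
  have S: "\<bar>?S p \<omega>\<bar> \<le> real p * (C / sqrt (real m))" if "p \<ge> m" for p
  proof -
    have "ereal (1 / real p * \<bar>?S p \<omega>\<bar>) \<le> (SUP p\<in>{max m 1..}. ereal (1 / real p * \<bar>?S p \<omega>\<bar>))"
      using that m by (intro SUP_upper) auto
    also have "\<dots> \<le> \<bar>SUP p\<in>{max m 1..}. ereal (1 / real p * \<bar>?S p \<omega>\<bar>)\<bar>"
      by (rule abs_ge)
    also note le
    finally have "1 / real p * \<bar>?S p \<omega>\<bar> \<le> C * (1 / sqrt (real m))"
      using m by simp
    then show ?thesis using that m by (simp add: field_simps)
  qed
  have "(\<Sum>j=m+1..m+kstar m. h2 M h Y (Y (int j) \<omega>)) = ?S (m + kstar m) \<omega> - ?S m \<omega>"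
    using sum.ub_add_nat[of 1 m "\<lambda>j. h2 M h Y (Y (int j) \<omega>)" "kstar m"] by simp
  then have "\<bar>\<Sum>j=m+1..m+kstar m. h2 M h Y (Y (int j) \<omega>)\<bar> \<le>
      real (m + kstar m) * (C / sqrt (real m)) + real m * (C / sqrt (real m))"
    using S[of m] S[of "m + kstar m"] by linarith
  also have "\<dots> \<le> (2 * real (k m)) * (C / sqrt (real m))"
    unfolding distrib_right[symmetric] using k[of m] \<open>C \<ge> 0\<close> by (intro mult_right_mono) auto
  finally have "sqrt (real m) / real (k m) * \<bar>\<Sum>j=m+1..m+kstar m. h2 M h Y (Y (int j) \<omega>)\<bar> \<le>
      sqrt (real m) / real (k m) * ((2 * real (k m)) * (C / sqrt (real m)))"
    by (intro mult_left_mono) auto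
  also have "\<dots> = 2 * C" using k[of m] m by simp
  finally show "\<bar>sqrt (real m) / real (k m) * (\<Sum>j=m+1..m+kstar m. h2 M h Y (Y (int j) \<omega>))\<bar> \<le> 2 * C"
    by (simp add: abs_mult)
qed

text \<open>The number \<open>n = k - kstar\<close> of terms is at least \<open>m\<close>, hence
  diverges as the hypothesis demands. Its normaliser \<open>sqrt n\<close> is absorbed through
  \<open>sqrt m * sqrt n \<le> k\<close>.\<close>

lemma stoch_bounded_h2_star:
  "stoch_bounded M (\<lambda>m \<omega>. sqrt (real m) / real (k m) *
     (\<Sum>j=m+kstar m+1..m+k m. h2_star M h Y Z m (Z m (int j) \<omega>)))"
    (is "stoch_bounded M (\<lambda>m \<omega>. _ * ?Q m \<omega>)")
proof (rule stoch_bounded_bigO_P)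
  define n where "n m = k m - kstar m" for m
  have n: "m \<le> n m" "m + kstar m + n m = m + k m" "n m \<le> k m" "0 < n m" for m
    using k[of m] by (auto simp: n_def)
  have "filterlim n at_top sequentially"
    using n by (intro filterlim_at_top_mono[OF filterlim_ident]) auto
  then have "bigO_P M (\<lambda>m \<omega>. ereal (1 / sqrt (real (n m)) *
          (\<Sum>j=m + kstar m + 1..m + kstar m + n m. h2_star M h Y Z m (Z m (int j) \<omega>))))
          (\<lambda>_. 1)"
    using A unfolding A_conditions_def by blast
  then show "bigO_P M (\<lambda>m \<omega>. ereal (1 / sqrt (real (n m)) * ?Q m \<omega>)) (\<lambda>_. 1)"
    unfolding n(2) .
  show "(\<lambda>\<omega>. ereal (1 / sqrt (real (n m)) * ?Q m \<omega>)) \<in> borel_measurable M" if "m \<ge> 1" for m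
    using measurable_Z[OF that, measurable] by measurable
  fix m \<omega> and C :: real
  assume "C \<ge> 0" and le: "\<bar>ereal (1 / sqrt (real (n m)) * ?Q m \<omega>)\<bar> \<le> ereal (C * 1)"
  have "\<bar>?Q m \<omega>\<bar> \<le> C * sqrt (real (n m))"
    using le n(4)[of m] by (simp add: abs_mult pos_divide_le_eq)
  then have "sqrt (real m) / real (k m) * \<bar>?Q m \<omega>\<bar> \<le>
      sqrt (real m) / real (k m) * (C * sqrt (real (n m)))"
    by (intro mult_left_mono) auto
  also have "\<dots> \<le> C * 1"
  proof -
    have "sqrt (real m) * sqrt (real (n m)) \<le> sqrt (real (k m)) * sqrt (real (k m))"
      using n[of m] by (intro mult_mono) auto
    then have "sqrt (real m) * sqrt (real (n m)) / real (k m) \<le> 1"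
      using n[of m] by simp
    from mult_left_mono[OF this \<open>C \<ge> 0\<close>] show ?thesis by (simp add: mult_ac)
  qed
  finally show "\<bar>sqrt (real m) / real (k m) * ?Q m \<omega>\<bar> \<le> 1 * C"
    by (simp add: abs_mult)
qed simp

text \<open>Serves both first-order terms of the historic sample, with \<open>n\<close> equal to
  \<open>kstar\<close> or \<open>k - kstar\<close>. Since \<open>sqrt m / m = 1 / sqrt m\<close>,
  the extra factor is \<open>n / k \<le> 1\<close>.\<close>

lemma stoch_bounded_scaled:
  assumes "stoch_bounded M (\<lambda>m \<omega>. 1 / sqrt (real m) * Q m \<omega>)" and "\<And>m. n m \<le> k m"
  shows "stoch_bounded M (\<lambda>m \<omega>. sqrt (real m) / real (k m) * (real (n m) / real m * Q m \<omega>))"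
  using assms(1)
proof (rule stoch_bounded_mono, intro always_eventually allI ballI)
  fix m \<omega>
  have "sqrt (real m) / real (k m) * (real (n m) / real m * Q m \<omega>) =
      real (n m) / real (k m) * (sqrt (real m) / real m * Q m \<omega>)"
    by simp
  then have "sqrt (real m) / real (k m) * (real (n m) / real m * Q m \<omega>) =
      real (n m) / real (k m) * (1 / sqrt (real m) * Q m \<omega>)"
    by (simp only: sqrt_divide_self_eq[of "real m"] inverse_eq_divide of_nat_0_le_iff)
  moreover have "real (n m) / real (k m) \<le> 1"
    using assms(2)[of m] k[of m] by simp
  ultimately show "\<bar>sqrt (real m) / real (k m) * (real (n m) / real m * Q m \<omega>)\<bar>
      \<le> \<bar>1 / sqrt (real m) * Q m \<omega>\<bar>"
    using mult_right_mono[of "real (n m) / real (k m)" 1 "\<bar>1 / sqrt (real m) * Q m \<omega>\<bar>"]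
    by (simp add: abs_mult)
qed

end

end

section \<open>Double sums and the weight at the evaluation times\<close>

lemma sum_decomposition:
  fixes r :: "'i \<Rightarrow> 'j \<Rightarrow> real"
  shows "(\<Sum>i\<in>I. \<Sum>j\<in>J. r i j + f i + g j + d) =
    (\<Sum>i\<in>I. \<Sum>j\<in>J. r i j) + real (card J) * (\<Sum>i\<in>I. f i) +
    real (card I) * (\<Sum>j\<in>J. g j) + real (card I) * real (card J) * d"
  by (simp add: sum.distrib sum_distrib_left)

text \<open>Away from the cut-off, \<open>w m k\<close> equals \<open>t * \<rho> t\<close> times
  \<open>sqrt m / k\<close> with \<open>t = k / m\<close>. It therefore suffices to keep
  \<open>t * \<rho> t\<close> away from zero along these \<open>t\<close>, all of which are at least
  \<open>1\<close>.\<close>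

lemma weight_lower_bound:
  assumes W: "weight_conditions w \<rho> \<gamma>"
    and V1: "filterlim (\<lambda>m. real (kstar m) / real m) at_top sequentially \<Longrightarrow>
          Liminf at_top (\<lambda>t. ereal (t * \<rho> t)) > 0"
    and regime: "filterlim (\<lambda>m. real (kstar m) / real m) at_top sequentially \<or>
          (\<exists>\<nu>>0. \<forall>m\<ge>1. real (kstar m) / real m < \<nu>) \<or>
          Liminf at_top (\<lambda>t. ereal (t * \<rho> t)) > 0"
    and K: "K \<ge> 1"
  obtains c where "c > 0"
    "\<forall>\<^sub>F m in sequentially. c * (sqrt (real m) / real (K * (kstar m + m + 1))) \<le>
       w m (K * (kstar m + m + 1))"
proof -
  obtain l :: "nat \<Rightarrow> real" where l: "(\<lambda>m. l m / real m) \<longlonglongrightarrow> 0"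
    and w: "\<And>m k. m \<ge> 1 \<Longrightarrow> k \<ge> 1 \<Longrightarrow> w m k =
           real m powr (- 1 / 2) * (if real k > l m then \<rho> (real k / real m) else 0)"
    and pos: "\<And>t. t > 0 \<Longrightarrow> \<rho> t > 0" and cont: "continuous_on {0<..} \<rho>"
    using W unfolding weight_conditions_def by blast
  define k where "k m = K * (kstar m + m + 1)" for m
  have le_k: "kstar m + m + 1 \<le> k m" for m using K by (cases K) (auto simp: k_def)
  have compact: "\<exists>c>0. \<forall>t\<in>{1..B}. c \<le> t * \<rho> t" if "B \<ge> 1" for B
  proof -
    have "continuous_on {1..B} (\<lambda>t. t * \<rho> t)"
      by (intro continuous_intros continuous_on_subset[OF cont]) auto
    then have "\<exists>s\<in>{1..B}. \<forall>t\<in>{1..B}. s * \<rho> s \<le> t * \<rho> t"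
      using that by (intro continuous_attains_inf) auto
    then obtain s where "s \<in> {1..B}" "\<forall>t\<in>{1..B}. s * \<rho> s \<le> t * \<rho> t" by blast
    then show ?thesis using pos[of s] by (intro exI[of _ "s * \<rho> s"]) auto
  qed
  have "\<exists>c>0. \<forall>m\<ge>1. c \<le> (real (k m) / real m) * \<rho> (real (k m) / real m)"
  \<comment> \<open>The split is on the liminf. If it fails to be positive, \<open>V1\<close>
    excludes \<open>kstar m / m\<close> tending to infinity, and \<open>regime\<close> leaves only
    the bounded case.\<close>
  proof (cases "Liminf at_top (\<lambda>t. ereal (t * \<rho> t)) > 0")
    case True
    then obtain c where c: "0 < ereal c" "ereal c < Liminf at_top (\<lambda>t. ereal (t * \<rho> t))"
      using ereal_dense2 by blast
    then obtain T where T: "\<And>t. t \<ge> T \<Longrightarrow> c < t * \<rho> t"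
      using less_LiminfD[OF c(2)] by (auto simp: eventually_at_top_linorder)
    \<comment> \<open>The liminf controls \<open>t \<ge> T\<close>; compactness fills the gap
      between \<open>1\<close> and \<open>T\<close>.\<close>
    obtain d where d: "d > 0" "\<And>t. t \<in> {1..max 1 T} \<Longrightarrow> d \<le> t * \<rho> t"
      using compact[of "max 1 T"] by auto
    have "min c d \<le> t * \<rho> t" if "t \<ge> 1" for t
      using T[of t] d(2)[of t] that by (cases "t \<ge> T") auto
    moreover have "real (k m) / real m \<ge> 1" if "m \<ge> 1" for m
      using le_k[of m] that by simp
    moreover have "min c d > 0" using c(1) d(1) by simp
    ultimately show ?thesis by blast
  next
    case False
    then obtain \<nu> where \<nu>: "\<nu> > 0" "\<And>m. m \<ge> 1 \<Longrightarrow> real (kstar m) / real m < \<nu>"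
      using V1 regime by blast
    \<comment> \<open>Obtained from \<open>k / m = K * (kstar / m + 1 + 1 / m)\<close> with
      \<open>kstar / m < \<nu>\<close> and \<open>1 / m \<le> 1\<close>.\<close>
    define B where "B = real K * (\<nu> + 2)"
    have range: "real (k m) / real m \<in> {1..B}" if m: "m \<ge> 1" for m
    proof -
      have "real (k m) / real m = real K * (real (kstar m) / real m + 1 + 1 / real m)"
        using m by (simp add: k_def field_simps)
      also have "\<dots> \<le> real K * (\<nu> + 1 + 1)"
        using \<nu>(2)[OF m] m by (intro mult_left_mono add_mono) auto
      finally show ?thesis using le_k[of m] m by (simp add: B_def add.commute)
    qed
    then have "B \<ge> 1" by force
    then show ?thesis using compact range by blast
  qed
  then obtain c where c: "c > 0"
    "\<And>m. m \<ge> 1 \<Longrightarrow> c \<le> (real (k m) / real m) * \<rho> (real (k m) / real m)"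
    by blast
  \<comment> \<open>Eventually \<open>l m < m \<le> k m\<close>, so the weight takes its nonzero
    branch.\<close>
  have "\<forall>\<^sub>F m in sequentially. l m / real m < 1"
    using l by (intro order_tendstoD(2)) auto
  with eventually_ge_at_top[of 1]
  have "\<forall>\<^sub>F m in sequentially. c * (sqrt (real m) / real (k m)) \<le> w m (k m)"
  proof eventually_elim
    case (elim m)
    then have "l m < real m" by (simp add: divide_less_eq)
    then have "real (k m) > l m" "k m \<ge> 1" using le_k[of m] by linarith+
    then have "w m (k m) = real m powr (- 1 / 2) * \<rho> (real (k m) / real m)"
      using w[OF elim(1)] by simp
    also have "real m powr (- 1 / 2) = sqrt (real m) / real m"
      by (simp add: powr_minus powr_half_sqrt inverse_eq_divide sqrt_divide_self_eq flip: minus_divide_left)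
    finally have w': "w m (k m) = sqrt (real m) / real m * \<rho> (real (k m) / real m)" .
    have "c * (sqrt (real m) / real (k m)) \<le>
        (real (k m) / real m) * \<rho> (real (k m) / real m) * (sqrt (real m) / real (k m))"
      using c(2)[of m] elim by (intro mult_right_mono) auto
    also have "\<dots> = w m (k m)"
      using \<open>k m \<ge> 1\<close> by (simp add: w')
    finally show ?case .
  qed
  then show ?thesis using c(1) that by (simp add: k_def)
qed

section \<open>Signal plus noise, and the divergence criterion\<close>

context change_point_model
begin

text \<open>The sum over \<open>j\<close> is cut at the change point, while the historic indices
  \<open>i\<close> always precede it. The first block uses the Hoeffding decomposition centred at
  \<open>\<theta>\<close>; in the second, centring at \<open>\<theta>\<close> instead of
  \<open>theta_star\<close> leaves one \<open>\<Delta> m\<close> per pair.\<close>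

lemma Gamma_decomposition:
  assumes m: "m \<ge> 1" and K: "kstar m \<le> K"
  shows "Gamma_stat h \<theta> X m K \<omega> - real (K - kstar m) * \<Delta> m =
    1 / real m * (\<Sum>i=1..m. \<Sum>j=m+1..m+kstar m. remainder M h Y (Y (int i) \<omega>) (Y (int j) \<omega>)) +
    real (kstar m) / real m * (\<Sum>i=1..m. h1 M h Y (Y (int i) \<omega>)) +
    (\<Sum>j=m+1..m+kstar m. h2 M h Y (Y (int j) \<omega>)) +
    1 / real m * (\<Sum>i=1..m. \<Sum>j=m+kstar m+1..m+K. remainder_star M h Y Z m (Y (int i) \<omega>) (Z m (int j) \<omega>)) +
    real (K - kstar m) / real m * (\<Sum>i=1..m. h1_star M h Y Z m (Y (int i) \<omega>)) +
    (\<Sum>j=m+kstar m+1..m+K. h2_star M h Y Z m (Z m (int j) \<omega>))"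
    (is "_ = 1 / real m * ?R + _ * ?H1 + ?H2 + 1 / real m * ?R' + _ * ?H1' + ?H2'")
proof -
  let ?s = "\<lambda>i j. h (X m i \<omega>) (X m j \<omega>) - \<theta>"
  have split: "sum g {m+1..m+K} = sum g {m+1..m+kstar m} + sum g {m+kstar m+1..m+K}" for g :: "nat \<Rightarrow> real"
    using sum.ub_add_nat[of "m + 1" "m + kstar m" g "K - kstar m"] K by simp
  have "(\<Sum>i=1..m. \<Sum>j=m+1..m+K. ?s i j) =
      (\<Sum>i=1..m. \<Sum>j=m+1..m+kstar m. ?s i j) + (\<Sum>i=1..m. \<Sum>j=m+kstar m+1..m+K. ?s i j)"
    unfolding split by (rule sum.distrib)
  also have "(\<Sum>i=1..m. \<Sum>j=m+1..m+kstar m. ?s i j) =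
      (\<Sum>i=1..m. \<Sum>j=m+1..m+kstar m. remainder M h Y (Y (int i) \<omega>) (Y (int j) \<omega>) +
         h1 M h Y (Y (int i) \<omega>) + h2 M h Y (Y (int j) \<omega>) + 0)"
    by (intro sum.cong refl) (auto simp: obs_def remainder_def)
  also have "\<dots> = ?R + real (kstar m) * ?H1 + real m * ?H2"
    by (subst sum_decomposition) simp
  also have "(\<Sum>i=1..m. \<Sum>j=m+kstar m+1..m+K. ?s i j) =
      (\<Sum>i=1..m. \<Sum>j=m+kstar m+1..m+K. remainder_star M h Y Z m (Y (int i) \<omega>) (Z m (int j) \<omega>) +
         h1_star M h Y Z m (Y (int i) \<omega>) + h2_star M h Y Z m (Z m (int j) \<omega>) + \<Delta> m)"
    by (intro sum.cong refl) (auto simp: obs_def remainder_star_def Delta_def)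
  also have "\<dots> = ?R' + real (K - kstar m) * ?H1' + real m * ?H2' + real m * real (K - kstar m) * \<Delta> m"
    by (subst sum_decomposition) simp
  finally have "Gamma_stat h \<theta> X m K \<omega> = 1 / real m *
      (?R + real (kstar m) * ?H1 + real m * ?H2 +
       (?R' + real (K - kstar m) * ?H1' + real m * ?H2' + real m * real (K - kstar m) * \<Delta> m))"
    unfolding Gamma_stat_def by (rule arg_cong)
  \<comment> \<open>The algebra is isolated in real variables, which shields the double sums from
    \<open>field_simps\<close>.\<close>
  moreover have "1 / t * (A + p * B + t * C + (A' + q * B' + t * C' + t * q * d)) - q * d =
      1 / t * A + p / t * B + C + 1 / t * A' + q / t * B' + C'"
    if "t > 0" for t p q d A B C A' B' C' :: real
    using that by (simp add: field_simps)
  ultimately show ?thesis using m by (simp only: of_nat_0_less_iff)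
qed

text \<open>The truncated subtraction makes the signal vanish up to the change point.\<close>

definition noise :: "nat \<Rightarrow> nat \<Rightarrow> 'a \<Rightarrow> real" where
  "noise m k \<omega> = Gamma_stat h \<theta> X m k \<omega> - real (k - kstar m) * \<Delta> m"

lemma stoch_bounded_noise:
  assumes k: "\<And>m. k m \<ge> kstar m + m + 1"
  shows "stoch_bounded M (\<lambda>m \<omega>. sqrt (real m) / real (k m) * noise m (k m) \<omega>)"
proof -
  have le: "kstar m \<le> k m" "k m - kstar m \<le> k m" for m using k[of m] by auto
  \<comment> \<open>The nesting follows the left-associated six-term sum, so both sides coincide
    once the prefactor is distributed.\<close>
  note bound = stoch_bounded_add[OF stoch_bounded_add[OF stoch_bounded_add[OF
      stoch_bounded_add[OF stoch_bounded_add[OF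
        stoch_bounded_remainder[OF k]
        stoch_bounded_scaled[OF k stoch_bounded_h1 le(1)]]
        stoch_bounded_h2_before[OF k]]
        stoch_bounded_remainder_star[OF k]]
        stoch_bounded_scaled[OF k stoch_bounded_h1_star le(2)]]
        stoch_bounded_h2_star[OF k]]
  show ?thesis
    by (rule stoch_bounded_mono[OF bound], rule eventually_mono[OF eventually_ge_at_top[of 1]])
      (intro ballI, simp only: noise_def Gamma_decomposition le distrib_left order_refl ball_simps simp_thms)
qed

text \<open>Common criterion for the three statistics: the supremum dominates its value at
  \<open>k m\<close>, and multiplication by \<open>sqrt m / k m\<close> turns the signal into
  \<open>\<delta> * sqrt m * \<bar>\<Delta> m\<bar>\<close>. Here \<open>\<delta>\<close> is the
  guaranteed fraction of the monitoring period that carries signal.\<close>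

lemma monitoring_sup_tendsto_infinity:
  assumes meas: "\<And>m k. m \<ge> 1 \<Longrightarrow> \<Psi> m k \<in> borel_measurable M"
    and signal: "filterlim (\<lambda>m. sqrt (real m) * \<bar>\<Delta> m\<bar>) at_top sequentially"
    and k: "\<And>m. k m \<ge> 1"
    and c: "c > 0" "\<forall>\<^sub>F m in sequentially. c * (sqrt (real m) / real (k m)) \<le> w m (k m)"
    and V: "stoch_bounded M (\<lambda>m \<omega>. sqrt (real m) / real (k m) * V m \<omega>)"
    and \<delta>: "\<delta> > 0"
    and lower: "\<And>m \<omega>. m \<ge> 1 \<Longrightarrow> \<bar>\<Psi> m (k m) \<omega>\<bar> \<ge> \<delta> * real (k m) * \<bar>\<Delta> m\<bar> - \<bar>V m \<omega>\<bar>"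
  shows "tendsto_infinity_in_prob M (monitoring_sup w \<Psi>)"
proof (rule tendsto_infinity_in_probI[OF measurable_monitoring_sup[OF meas] V _ c(1)])
  show "filterlim (\<lambda>m. \<delta> * (sqrt (real m) * \<bar>\<Delta> m\<bar>)) at_top sequentially"
    using signal \<delta> by (intro filterlim_tendsto_pos_mult_at_top[OF tendsto_const])
  show "\<forall>\<^sub>F m in sequentially. \<forall>\<omega>\<in>space M. monitoring_sup w \<Psi> m \<omega> \<ge>
      ereal (c * (\<delta> * (sqrt (real m) * \<bar>\<Delta> m\<bar>) - \<bar>sqrt (real m) / real (k m) * V m \<omega>\<bar>))"
    using c(2) eventually_ge_at_top[of 1]
  proof eventually_elim
    case (elim m)
    show ?case
    proof
      fix \<omega>
      define q where "q = sqrt (real m) / real (k m)"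
      have "q \<ge> 0" by (simp add: q_def)
      have "q * real (k m) = sqrt (real m)" using k[of m] by (simp add: q_def)
      then have "\<delta> * (sqrt (real m) * \<bar>\<Delta> m\<bar>) - \<bar>q * V m \<omega>\<bar> = q * (\<delta> * real (k m) * \<bar>\<Delta> m\<bar> - \<bar>V m \<omega>\<bar>)"
        using \<open>q \<ge> 0\<close> by (simp add: algebra_simps abs_mult)
      also have "\<dots> \<le> q * \<bar>\<Psi> m (k m) \<omega>\<bar>"
        using lower[OF elim(2)] \<open>q \<ge> 0\<close> by (intro mult_left_mono)
      finally have "c * (\<delta> * (sqrt (real m) * \<bar>\<Delta> m\<bar>) - \<bar>q * V m \<omega>\<bar>) \<le> c * q * \<bar>\<Psi> m (k m) \<omega>\<bar>"
        using c(1) by (simp add: mult.assoc mult_left_mono)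
      also have "\<dots> \<le> w m (k m) * \<bar>\<Psi> m (k m) \<omega>\<bar>"
        using elim(1) by (intro mult_right_mono) (auto simp: q_def)
      finally have "ereal (c * (\<delta> * (sqrt (real m) * \<bar>\<Delta> m\<bar>) - \<bar>q * V m \<omega>\<bar>)) \<le>
          ereal (w m (k m) * \<bar>\<Psi> m (k m) \<omega>\<bar>)" by simp
      also have "\<dots> \<le> monitoring_sup w \<Psi> m \<omega>"
        unfolding monitoring_sup_def using k[of m] by (intro SUP_upper) auto
      finally show "monitoring_sup w \<Psi> m \<omega> \<ge>
          ereal (c * (\<delta> * (sqrt (real m) * \<bar>\<Delta> m\<bar>) - \<bar>sqrt (real m) / real (k m) * V m \<omega>\<bar>))"
        by (simp add: q_def)
    qed
  qed
qed

lemma abs_Gamma_ge: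
  "\<bar>Gamma_stat h \<theta> X m k \<omega>\<bar> \<ge> real (k - kstar m) * \<bar>\<Delta> m\<bar> - \<bar>noise m k \<omega>\<bar>"
  using abs_triangle_ineq4[of "Gamma_stat h \<theta> X m k \<omega>" "noise m k \<omega>"]
  by (simp add: noise_def abs_mult)

end

section \<open>Divergence of the three monitoring statistics\<close>

theorem theorem3:
  fixes M :: "'a measure" and N :: "'c measure"
    and h :: "real \<Rightarrow> real \<Rightarrow> real" and b \<gamma> :: real
    and Y :: "int \<Rightarrow> 'a \<Rightarrow> real" and Z :: "nat \<Rightarrow> int \<Rightarrow> 'a \<Rightarrow> real"
    and kstar :: "nat \<Rightarrow> nat"
    and w :: "nat \<Rightarrow> nat \<Rightarrow> real" and \<rho> :: "real \<Rightarrow> real"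
    and W :: "real \<Rightarrow> 'c \<Rightarrow> real \<times> real"
  assumes "prob_space M"
    and "case_prod h \<in> borel_measurable borel"
    and "0 < b" "b < 1"
    and "stationary_process M Y"
    and "\<And>m. m \<ge> 1 \<Longrightarrow> stationary_process M (Z m)"
    and "integrable (product_law M (Y 1) (Y 1)) (case_prod h)"
    and "\<And>m. m \<ge> 1 \<Longrightarrow> integrable (product_law M (Y 1) (Z m 1)) (case_prod h)"
    and "weight_conditions w \<rho> \<gamma>"
    and "R_conditions M h Y \<gamma> N W"
    and "A_conditions M h Y Z kstar"
    and "filterlim (\<lambda>m. sqrt (real m) * \<bar>Delta M h Y Z m\<bar>) at_top sequentially"
    and V1: "filterlim (\<lambda>m. real (kstar m) / real m) at_top sequentially \<Longrightarrow>
          Liminf at_top (\<lambda>t. ereal (t * \<rho> t)) > 0"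
    and regime: "filterlim (\<lambda>m. real (kstar m) / real m) at_top sequentially \<or>
          (\<exists>\<nu>>0. \<forall>m\<ge>1. real (kstar m) / real m < \<nu>) \<or>
          Liminf at_top (\<lambda>t. ereal (t * \<rho> t)) > 0"
  shows "(((\<exists>\<nu>>0. \<forall>m\<ge>1. real (kstar m) / real m < \<nu>) \<longrightarrow>
            (\<exists>\<nu>>0. (\<forall>m\<ge>1. real (kstar m) / real m < \<nu>) \<and>
               (\<exists>t0>\<nu>. \<exists>\<epsilon>>0. \<forall>t\<in>{t0 - \<epsilon><..<t0 + \<epsilon>}. \<rho> t > 0))) \<longrightarrow>
         tendsto_infinity_in_prob M
           (monitoring_sup w (cusum h (theta M h Y) (obs Y Z kstar))) \<and>
         tendsto_infinity_in_prob M
           (monitoring_sup w (page_cusum h (theta M h Y) (obs Y Z kstar)))) \<and>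
        (((\<exists>\<nu>>0. \<forall>m\<ge>1. real (kstar m) / real m < \<nu>) \<longrightarrow>
            (\<exists>\<nu>>0. (\<forall>m\<ge>1. real (kstar m) / real m < \<nu>) \<and>
               (\<exists>t0>\<nu>. \<exists>\<epsilon>>0. \<forall>t\<in>{t0 / b - \<epsilon><..<t0 / b + \<epsilon>}. \<rho> t > 0))) \<longrightarrow>
         tendsto_infinity_in_prob M
           (monitoring_sup w (modified_mosum b h (theta M h Y) (obs Y Z kstar))))"
proof -
  note W = assms(9)
  have Y: "\<And>i. Y i \<in> borel_measurable M" and Z: "\<And>m i. m \<ge> 1 \<Longrightarrow> Z m i \<in> borel_measurable M"
    using assms(5,6) by (auto simp: stationary_process_def)
  interpret prob_space M by fact
  interpret change_point_model M N h \<gamma> Y Z kstar W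
    using Y Z assms(2,9-11) by unfold_locales (auto simp: weight_conditions_def)
  \<comment> \<open>\<open>K * b \<ge> 2\<close> takes care of the MOSUM index \<open>k' m\<close>.
    As \<open>b < 1\<close>, also \<open>K \<ge> 2\<close>, so at least half of the monitoring
    period lies after the change; hence \<open>\<delta> = 1 / 2\<close> for CUSUM and
    Page-CUSUM.\<close>
  define K where "K = nat \<lceil>2 / b\<rceil>"
  have K: "2 / b \<le> real K" unfolding K_def by linarith
  moreover have "2 < 2 / b" using assms(3,4) by (simp add: pos_less_divide_eq)
  ultimately have K2: "K \<ge> 2" by linarith
  have Kb: "2 \<le> real K * b" using K assms(3) by (simp add: pos_divide_le_eq)
  define k where "k m = K * (kstar m + m + 1)" for m
  define k' where "k' m = nat \<lfloor>real (k m) * b\<rfloor>" for m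
  have k: "2 * (kstar m + m + 1) \<le> k m" for m
    unfolding k_def by (rule mult_right_mono[OF K2]) simp
  have k1: "k m \<ge> kstar m + m + 1" and k_pos: "k m \<ge> 1" for m using k[of m] by auto
  have k'_le: "real (k' m) \<le> real (k m) * b" for m
    using assms(3) by (simp add: k'_def)
  have k'_le_k: "k' m \<le> k m" for m
  proof -
    have "real (k m) * b \<le> real (k m)" using assms(4) by (simp add: mult_left_le)
    then show ?thesis using k'_le[of m] by linarith
  qed
  have k': "k' m \<ge> kstar m + m + 1" for m
  proof -
    have "real (kstar m + m + 1) * 1 \<le> real (kstar m + m + 1) * (real K * b)"
      using Kb by (intro mult_left_mono) auto
    also have "\<dots> = real (k m) * b" by (simp add: k_def algebra_simps)
    finally show ?thesis unfolding k'_def by (simp add: le_nat_floor)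
  qed
  have "1 \<le> K" using K2 by simp
  from weight_lower_bound[OF W V1 regime this] obtain c where c: "c > 0"
    "\<forall>\<^sub>F m in sequentially. c * (sqrt (real m) / real (k m)) \<le> w m (k m)"
    unfolding k_def by blast
  note criterion = monitoring_sup_tendsto_infinity[where k = k and c = c and w = w, OF _ assms(12) k_pos c]
  note noise = stoch_bounded_noise[of k, OF k1]
  have lower: "\<bar>Gamma_stat h \<theta> X m (k m) \<omega>\<bar> \<ge> 1 / 2 * real (k m) * \<bar>\<Delta> m\<bar> - \<bar>noise m (k m) \<omega>\<bar>" for m \<omega>
  proof -
    have "k m \<le> 2 * (k m - kstar m)" using k[of m] by simp
    then have "real (k m) \<le> real (2 * (k m - kstar m))" by (simp only: of_nat_le_iff)
    then have "1 / 2 * real (k m) \<le> real (k m - kstar m)" by simp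
    then have "1 / 2 * real (k m) * \<bar>\<Delta> m\<bar> \<le> real (k m - kstar m) * \<bar>\<Delta> m\<bar>"
      by (rule mult_right_mono) simp
    then show ?thesis using abs_Gamma_ge[of "k m" m \<omega>] by linarith
  qed
  have "tendsto_infinity_in_prob M (monitoring_sup w (cusum h \<theta> X))"
  proof (rule criterion[OF _ noise, where \<delta> = "1 / 2"])
    show "cusum h \<theta> X m n \<in> borel_measurable M" if "m \<ge> 1" for m n
      using measurable_Gamma[OF that] by (simp add: cusum_def[abs_def])
    show "\<bar>cusum h \<theta> X m (k m) \<omega>\<bar> \<ge> 1 / 2 * real (k m) * \<bar>\<Delta> m\<bar> - \<bar>noise m (k m) \<omega>\<bar>" for m \<omega>
      using lower by (simp add: cusum_def)
  qed simp
  moreover have "tendsto_infinity_in_prob M (monitoring_sup w (page_cusum h \<theta> X))"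
  proof (rule criterion[OF measurable_page_cusum noise, where \<delta> = "1 / 2"])
    fix m \<omega>
    \<comment> \<open>The choice \<open>l = 0\<close>, where \<open>Gamma_stat\<close> vanishes,
      shows that Page-CUSUM dominates CUSUM.\<close>
    have "\<bar>Gamma_stat h \<theta> X m (k m) \<omega> - Gamma_stat h \<theta> X m 0 \<omega>\<bar> \<le> page_cusum h \<theta> X m (k m) \<omega>"
      unfolding page_cusum_def by (rule cSUP_upper) auto
    then have "\<bar>Gamma_stat h \<theta> X m (k m) \<omega>\<bar> \<le> page_cusum h \<theta> X m (k m) \<omega>"
      by (simp add: Gamma_stat_def)
    then show "\<bar>page_cusum h \<theta> X m (k m) \<omega>\<bar> \<ge> 1 / 2 * real (k m) * \<bar>\<Delta> m\<bar> - \<bar>noise m (k m) \<omega>\<bar>"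
      using lower[of m \<omega>] by linarith
  qed auto
  moreover have "tendsto_infinity_in_prob M (monitoring_sup w (modified_mosum b h \<theta> X))"
  proof (rule criterion)
    show "modified_mosum b h \<theta> X m n \<in> borel_measurable M" if "m \<ge> 1" for m n
      using measurable_Gamma[OF that] by (simp add: modified_mosum_def[abs_def])
    \<comment> \<open>The bound at \<open>k' m\<close> comes with the normaliser
      \<open>1 / k' m\<close>, which is at least \<open>1 / k m\<close>. The minus sign prepares the
      difference of the two noises.\<close>
    have "stoch_bounded M (\<lambda>m \<omega>. sqrt (real m) / real (k m) * - noise m (k' m) \<omega>)"
      using stoch_bounded_noise[of k', OF k']
    proof (rule stoch_bounded_mono, intro always_eventually allI ballI)
      fix m \<omega>
      have "0 < k' m" using k'[of m] by linarith
      then have "sqrt (real m) / real (k m) \<le> sqrt (real m) / real (k' m)"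
        using k'_le_k[of m] by (intro divide_left_mono) auto
      then show "\<bar>sqrt (real m) / real (k m) * - noise m (k' m) \<omega>\<bar> \<le>
          \<bar>sqrt (real m) / real (k' m) * noise m (k' m) \<omega>\<bar>"
        unfolding abs_mult abs_minus by (intro mult_right_mono) auto
    qed
    from stoch_bounded_add[OF noise this]
    show "stoch_bounded M (\<lambda>m \<omega>. sqrt (real m) / real (k m) * (noise m (k m) \<omega> - noise m (k' m) \<omega>))"
      by (simp add: right_diff_distrib)
    show "1 - b > 0" using assms(4) by simp
    fix m \<omega>
    \<comment> \<open>Both times are past the change, so \<open>kstar m\<close> cancels from the
      signals. The remaining length \<open>k m - k' m\<close> is at least
      \<open>(1 - b) * k m\<close>, which gives \<open>\<delta> = 1 - b\<close>.\<close>
    have diff: "modified_mosum b h \<theta> X m (k m) \<omega> =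
        real (k m - k' m) * \<Delta> m + (noise m (k m) \<omega> - noise m (k' m) \<omega>)"
      using k'[of m] k'_le_k[of m]
      unfolding modified_mosum_def noise_def k'_def[symmetric] by (simp add: of_nat_diff algebra_simps)
    have "(1 - b) * real (k m) \<le> real (k m - k' m)"
      using k'_le[of m] k'_le_k[of m] by (simp add: of_nat_diff algebra_simps)
    then have "(1 - b) * real (k m) * \<bar>\<Delta> m\<bar> \<le> \<bar>real (k m - k' m) * \<Delta> m\<bar>"
      unfolding abs_mult by (intro mult_mono) auto
    then show "\<bar>modified_mosum b h \<theta> X m (k m) \<omega>\<bar> \<ge>
        (1 - b) * real (k m) * \<bar>\<Delta> m\<bar> - \<bar>noise m (k m) \<omega> - noise m (k' m) \<omega>\<bar>"
      unfolding diff by linarith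
  qed
  ultimately show ?thesis by blast
qed

end
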